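(* For all $\mu\in\mathbb{R}$, $\lambda>\max\{2(1+\mu),0\}$ and $k>0$, one has $$\lambda\int_0^\infty e^{-\lambda t}\,E\big[(A_t^{(\mu)}-k)_+\big]\,dt=\frac{1}{(\lambda-2(1+\mu))\,\Gamma(b-1)}\int_0^{1/(2k)}e^{-t}\,t^{b-2}(1-2kt)^{a+1}\,dt,$$ where $\nu=\sqrt{2\lambda+\mu^2}$, $a=(\nu+\mu)/2$ and $b=(\nu-\mu)/2$.
   Context: $B=\{B_t,t\ge 0\}$ is a one-dimensional Brownian motion with $B_0=0$ on a probability space with expectation $E$; $B_t^{(\mu)}=B_t+\mu t$; $A_t^{(\mu)}=\int_0^t\exp(2B_s^{(\mu)})\,ds$; $x_+=\max\{x,0\}$; $\Gamma$ is the Gamma function. *)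

theory Defs
  imports "HOL-Probability.Probability"
begin

text \<open>
  Standard one-dimensional Brownian motion started at 0, indexed by the reals of which only the
  times \<open>t \<ge> 0\<close> are constrained. Paths are continuous for every \<open>\<omega>\<close>, not merely almost surely:
  \<open>M\<close> need not be complete, and this keeps the path functionals below measurable.
\<close>
locale brownian_motion = prob_space M
  for M :: "'a measure" and B :: "real \<Rightarrow> 'a \<Rightarrow> real" +
  assumes random_variable_B: "\<And>t. 0 \<le> t \<Longrightarrow> random_variable borel (B t)"
    and B_zero: "\<And>\<omega>. \<omega> \<in> space M \<Longrightarrow> B 0 \<omega> = 0"
    and continuous_paths: "\<And>\<omega>. \<omega> \<in> space M \<Longrightarrow> continuous_on {0..} (\<lambda>t. B t \<omega>)"
    and normal_increments: "\<And>s t. 0 \<le> s \<Longrightarrow> s < t \<Longrightarrow>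
      distributed M lborel (\<lambda>\<omega>. B t \<omega> - B s \<omega>) (normal_density 0 (sqrt (t - s)))"
    and independent_increments: "\<And>(n::nat) \<tau>. 0 \<le> \<tau> 0 \<Longrightarrow> (\<And>i. i < n \<Longrightarrow> \<tau> i < \<tau> (Suc i)) \<Longrightarrow>
      indep_vars (\<lambda>_. borel) (\<lambda>i \<omega>. B (\<tau> (Suc i)) \<omega> - B (\<tau> i) \<omega>) {..<n}"

definition drifted :: "(real \<Rightarrow> 'a \<Rightarrow> real) \<Rightarrow> real \<Rightarrow> real \<Rightarrow> 'a \<Rightarrow> real" where
  "drifted B \<mu> t \<omega> = B t \<omega> + \<mu> * t"

definition exp_functional :: "(real \<Rightarrow> 'a \<Rightarrow> real) \<Rightarrow> real \<Rightarrow> real \<Rightarrow> 'a \<Rightarrow> real" where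
  "exp_functional B \<mu> t \<omega> = (LINT s:{0..t}|lborel. exp (2 * drifted B \<mu> s \<omega>))"

definition pos_part :: "real \<Rightarrow> real" where
  "pos_part x = max x 0"

end

theory Submission
  imports Defs "HOL-Real_Asymp.Real_Asymp"
begin

text \<open>
  Let \<open>T\<close> be exponential with rate \<open>\<lambda>\<close>, independent of \<open>B\<close>. The left-hand side is
  \<open>E (A_T - k)_+\<close>, and the right-hand side is \<open>E (Z / (2 G) - k)_+\<close> for independent variables
  \<open>Z\<close> of law beta(1, a) and \<open>G\<close> of law gamma(b). It therefore suffices that \<open>A_T\<close> and \<open>Z / (2 G)\<close>
  have the same law (Yor), which is seen on Laplace transforms \<open>u \<theta>\<close>.

  Since \<open>A_{t+h} = A_h + exp (2 B_h + 2 \<mu> h) A'_t\<close>, where \<open>A'_t\<close> is a copy of \<open>A_t\<close> independent of \<open>B_h\<close>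
  and \<open>A_h\<close> differs from \<open>h\<close> by \<open>o(h)\<close> in mean, splitting \<open>T\<close> at a small time \<open>h\<close> gives
  \<open>u \<theta> = (1 - exp (- \<lambda> h)) + exp (- (\<lambda> + \<theta>) h) E (u (\<theta> exp (2 B_h + 2 \<mu> h))) + o(h)\<close>.
  This relation determines \<open>u\<close>: at a positive maximum of the difference of two solutions it is
  violated. No smoothness of \<open>u\<close> and no stochastic calculus is needed. For \<open>Z / (2 G)\<close>
  the relation follows from a Taylor expansion and two integrations by parts.
\<close>

subsection \<open>Laplace transforms of laws on the half-line\<close>

text \<open>The parameters are forced by \<nu>: \<mu> = a - b, and \<nu>^2 - \<mu>^2 = 4 a b gives
  lam = 2 a b. Moreover lam - 2 (1 + \<mu>) = 2 (b - 1) (a + 1), so the condition on lam means b >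
  1, which is exactly finiteness of E (1 / G). The candidate law comes from time reversal. At a
  fixed time A_t has the law of X_t, where dX = (2 (1 + \<mu>) X + 1) dt + 2 X dB and X_0 = 0; with
  L the generator of X, the law of A_T integrates (lam - L) f to lam f(0). This identity is checked
  for the ratio law, and only on f(x) = exp (- \<theta> x). Two obstacles shape the rest. Z / (2 G)
  has a moment of order p > 0 only for p < b, so no expansion may use moments of the law: all
  remainders must be uniform in x. And \<theta> ranges over an unbounded half-line, so a maximum
  exists only because the difference of the transforms vanishes at 0 and at infinity; the latter
  holds because neither law charges 0, and this is why almost sure strict positivity is carried
  along. Finiteness of the left-hand side is not known beforehand; it is imported from the ratio law
  by computing with extended nonnegative integrals.\<close>

lemma integral_abs_diff_le:
  fixes f g :: "'a \<Rightarrow> real"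
  assumes "prob_space M" "integrable M f" "integrable M g" "AE x in M. \<bar>f x - g x\<bar> \<le> e"
  shows "\<bar>(\<integral>x. f x \<partial>M) - (\<integral>x. g x \<partial>M)\<bar> \<le> e"
proof -
  interpret prob_space M by fact
  have "\<bar>(\<integral>x. f x \<partial>M) - (\<integral>x. g x \<partial>M)\<bar> = \<bar>\<integral>x. f x - g x \<partial>M\<bar>"
    using assms by simp
  also have "\<dots> \<le> (\<integral>x. \<bar>f x - g x\<bar> \<partial>M)"
    by (rule integral_abs_bound)
  also have "\<dots> \<le> (\<integral>x. e \<partial>M)"
    by (rule integral_mono_AE) (use assms in auto)
  finally show ?thesis by (simp add: prob_space)
qed

text \<open>Only the values of \<open>f\<close> on [0,1] matter, and there Weierstrass replaces
  \<open>f\<close> by a polynomial, whose integral is a combination of moments. The global bound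
  makes \<open>f\<close> integrable.\<close>

lemma integral_eq_of_moments_eq:
  fixes V W :: "real measure" and f :: "real \<Rightarrow> real"
  assumes V: "real_distribution V" "AE v in V. v \<in> {0..1}"
    and W: "real_distribution W" "AE v in W. v \<in> {0..1}"
    and moments: "\<And>n. (\<integral>v. v ^ n \<partial>V) = (\<integral>v. v ^ n \<partial>W)"
    and f: "continuous_on UNIV f" "\<And>x. \<bar>f x\<bar> \<le> C"
  shows "(\<integral>v. f v \<partial>V) = (\<integral>v. f v \<partial>W)"
proof -
  interpret V: real_distribution V by fact
  interpret W: real_distribution W by fact
  have [measurable]: "f \<in> borel_measurable borel"
    using f by (simp add: borel_measurable_continuous_onI)
  have "\<bar>(\<integral>v. f v \<partial>V) - (\<integral>v. f v \<partial>W)\<bar> \<le> 2 * e" if e: "e > 0" for e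
  proof -
    obtain g where g: "real_polynomial_function g" "\<And>x. x \<in> {0..1::real} \<Longrightarrow> \<bar>f x - g x\<bar> < e"
      using Stone_Weierstrass_real_polynomial_function[OF compact_Icc continuous_on_subset[OF f(1) subset_UNIV] e]
      by blast
    then obtain c n where gs: "g = (\<lambda>x. \<Sum>i\<le>n. c i * x ^ i)"
      using real_polynomial_function_iff_sum by auto
    have pow: "integrable N (\<lambda>v. v ^ i)" if "real_distribution N" "AE v in N. v \<in> {0..1}" for N :: "real measure" and i
    proof -
      interpret real_distribution N by fact
      show ?thesis
      proof (rule integrable_const_bound[where B = 1])
        show "AE v in N. norm (v ^ i) \<le> 1"
          using that(2) by (rule eventually_mono) (auto simp: power_le_one)
      qed simp
    qed
    have fi: "integrable N f" if "real_distribution N" for N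
    proof -
      interpret real_distribution N by fact
      show ?thesis by (rule integrable_const_bound[where B = C]) (use f in auto)
    qed
    have gi: "integrable V g" "integrable W g" "(\<integral>v. g v \<partial>V) = (\<integral>v. g v \<partial>W)"
      using pow[OF V] pow[OF W] moments by (auto simp: gs)
    have "\<bar>(\<integral>v. f v \<partial>V) - (\<integral>v. g v \<partial>V)\<bar> \<le> e"
      by (rule integral_abs_diff_le[OF V.prob_space_axioms fi[OF V(1)] gi(1)], rule eventually_mono[OF V(2)])
         (use g in \<open>auto intro: less_imp_le\<close>)
    moreover have "\<bar>(\<integral>v. f v \<partial>W) - (\<integral>v. g v \<partial>W)\<bar> \<le> e"
      by (rule integral_abs_diff_le[OF W.prob_space_axioms fi[OF W(1)] gi(2)], rule eventually_mono[OF W(2)])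
         (use g in \<open>auto intro: less_imp_le\<close>)
    ultimately show ?thesis using gi(3) by linarith
  qed
  \<comment> \<open>With e a third of the gap d, the bound reads |d| \<le> 2 |d| / 3, which forces d
    = 0.\<close>
  from this[of "\<bar>(\<integral>v. f v \<partial>V) - (\<integral>v. f v \<partial>W)\<bar> / 3"] show ?thesis
    by (cases "(\<integral>v. f v \<partial>V) = (\<integral>v. f v \<partial>W)") auto
qed

text \<open>Cosine and sine are bounded and continuous, so the moments fix the real and imaginary
  parts of the characteristic function.\<close>

lemma real_distribution_eqI_moments:
  fixes V W :: "real measure"
  assumes V: "real_distribution V" "AE v in V. v \<in> {0..1}"
    and W: "real_distribution W" "AE v in W. v \<in> {0..1}"
    and moments: "\<And>n. (\<integral>v. v ^ n \<partial>V) = (\<integral>v. v ^ n \<partial>W)"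
  shows "V = W"
proof (rule Levy_uniqueness[OF V(1) W(1)], rule ext)
  fix t
  have *: "char N t = Complex (\<integral>v. cos (t * v) \<partial>N) (\<integral>v. sin (t * v) \<partial>N)" if "real_distribution N" for N
  proof -
    interpret real_distribution N by fact
    have i: "integrable N (\<lambda>v. iexp (t * v))" by (rule integrable_const_bound[where B = 1]) auto
    show ?thesis
      by (rule complex_eqI)
         (use integral_Re[OF i] integral_Im[OF i] in \<open>simp_all add: char_def Re_exp Im_exp\<close>)
  qed
  have "(\<integral>v. cos (t * v) \<partial>V) = (\<integral>v. cos (t * v) \<partial>W)"
    by (rule integral_eq_of_moments_eq[OF assms, where C = 1]) (auto intro!: continuous_intros)
  moreover have "(\<integral>v. sin (t * v) \<partial>V) = (\<integral>v. sin (t * v) \<partial>W)"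
    by (rule integral_eq_of_moments_eq[OF assms, where C = 1]) (auto intro!: continuous_intros)
  ultimately show "char V t = char W t" using V W by (simp add: *)
qed

definition laplace :: "real measure \<Rightarrow> real \<Rightarrow> real" where
  "laplace N \<theta> = (\<integral>x. exp (- \<theta> * x) \<partial>N)"

text \<open>The map x -> exp (- x) carries the half-line into [0,1] and turns the transform at an
  integer n into the n-th moment. Values at integers therefore determine the image law, and - ln
  recovers the original one.\<close>

lemma laplace_unique:
  fixes N N' :: "real measure"
  assumes N: "real_distribution N" "AE x in N. 0 \<le> x"
    and N': "real_distribution N'" "AE x in N'. 0 \<le> x"
    and eq: "\<And>\<theta>. \<theta> > 0 \<Longrightarrow> laplace N \<theta> = laplace N' \<theta>"
  shows "N = N'"
proof -
  define E where "E = (\<lambda>N. distr N borel (\<lambda>x::real. exp (- x)))"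
  have E: "real_distribution (E K) \<and> (AE v in E K. v \<in> {0..1}) \<and> K = distr (E K) borel (\<lambda>v. - ln v)
      \<and> (\<forall>n. (\<integral>v. v ^ n \<partial>E K) = laplace K (real n))"
    if K: "real_distribution K" "AE x in K. 0 \<le> x" for K
  proof -
    interpret real_distribution K by fact
    have [measurable]: "(\<lambda>x::real. exp (- x)) \<in> measurable K borel" by simp
    have "real_distribution (E K)"
      unfolding E_def by (simp add: real_distribution_def real_distribution_axioms_def prob_space_distr)
    moreover have "AE v in E K. v \<in> {0..1}"
      unfolding E_def by (subst AE_distr_iff) (use K in \<open>auto elim: eventually_mono\<close>)
    moreover have "distr (E K) borel (\<lambda>v. - ln v) = K"
      unfolding E_def by (subst distr_distr) (auto simp: o_def distr_id2)
    moreover have "(\<integral>v. v ^ n \<partial>E K) = laplace K (real n)" for n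
      unfolding E_def laplace_def
      by (subst integral_distr) (auto simp: exp_of_nat_mult[symmetric] simp flip: exp_of_nat_mult)
    ultimately show ?thesis by simp
  qed
  have "laplace N (real n) = laplace N' (real n)" for n
  \<comment> \<open>The hypothesis covers positive arguments only; at 0 both transforms are the
    total mass.\<close>
  proof (cases "n = 0")
    case True
    interpret N: real_distribution N by fact
    interpret N': real_distribution N' by fact
    show ?thesis using True N.prob_space N'.prob_space by (simp add: laplace_def)
  qed (simp add: eq)
  then have "E N = E N'"
    using E[OF N] E[OF N'] by (intro real_distribution_eqI_moments) auto
  then show ?thesis using E[OF N] E[OF N'] by metis
qed

text \<open>On the half-line the constant 1 dominates every exp (- \<theta> x), so one argument
  yields both continuity and the behaviour at infinity.\<close>

lemma laplace_sequentially:
  fixes N :: "real measure"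
  assumes N: "real_distribution N" and "AE x in N. (\<lambda>n. exp (- \<theta> n * x)) \<longlonglongrightarrow> l x"
    and "AE x in N. 0 \<le> x" "\<And>n. 0 \<le> \<theta> n" and [measurable]: "l \<in> borel_measurable borel"
  shows "(\<lambda>n. laplace N (\<theta> n)) \<longlonglongrightarrow> (\<integral>x. l x \<partial>N)"
  unfolding laplace_def
proof (rule integral_dominated_convergence[where w = "\<lambda>_. 1"])
  interpret real_distribution N by fact
  show "integrable N (\<lambda>_. 1::real)" by simp
  show "l \<in> borel_measurable N" "\<And>n. (\<lambda>x. exp (- \<theta> n * x)) \<in> borel_measurable N" by simp_all
  show "AE x in N. norm (exp (- \<theta> n * x)) \<le> 1" for n
    using assms(3) by (auto elim!: eventually_mono simp: assms(4))
qed fact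

lemma continuous_on_laplace:
  assumes "real_distribution N" "AE x in N. 0 \<le> x"
  shows "continuous_on {0..} (laplace N)"
  unfolding continuous_on_sequentially
proof (intro ballI allI impI)
  fix u a assume "a \<in> {0..}" "(\<forall>n. u n \<in> {0::real..}) \<and> u \<longlonglongrightarrow> a"
  then have "(\<lambda>n. laplace N (u n)) \<longlonglongrightarrow> (\<integral>x. exp (- a * x) \<partial>N)"
    using assms by (intro laplace_sequentially) (auto intro!: tendsto_intros)
  then show "(laplace N \<circ> u) \<longlonglongrightarrow> laplace N a" by (simp add: o_def laplace_def)
qed

text \<open>In general the limit is the mass at 0, hence the strict positivity.\<close>

lemma laplace_tendsto_0:
  assumes "real_distribution N" "AE x in N. 0 < x"
  shows "(laplace N \<longlongrightarrow> 0) at_top"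
proof (rule tendsto_at_topI_sequentially)
  fix X :: "nat \<Rightarrow> real" assume X: "filterlim X at_top sequentially"
  \<comment> \<open>A sequence tending to infinity may start with negative terms, where exp (-
    \<theta> x) is not bounded by 1. Truncation changes finitely many terms only.\<close>
  define Y where "Y = (\<lambda>n. max (X n) 0)"
  have Y: "filterlim Y at_top sequentially"
    using X unfolding Y_def by (rule filterlim_at_top_mono) auto
  have "(\<lambda>n. laplace N (Y n)) \<longlonglongrightarrow> (\<integral>x. 0 \<partial>N)"
  proof (rule laplace_sequentially)
    have "(\<lambda>n. exp (- Y n * x)) \<longlonglongrightarrow> 0" if "0 < x" for x
      by (intro filterlim_compose[OF exp_at_bot])
         (use Y that in \<open>auto simp: filterlim_uminus_at_bot intro!: filterlim_at_top_mult_tendsto_pos[OF tendsto_const]\<close>)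
    then show "AE x in N. (\<lambda>n. exp (- Y n * x)) \<longlonglongrightarrow> 0"
      using assms(2) by (auto elim!: eventually_mono)
  qed (use assms in \<open>auto simp: Y_def elim!: eventually_mono\<close>)
  moreover have "eventually (\<lambda>n. laplace N (Y n) = laplace N (X n)) sequentially"
    using X[unfolded filterlim_at_top, rule_format, of 0] by eventually_elim (simp add: Y_def)
  ultimately show "(\<lambda>n. laplace N (X n)) \<longlonglongrightarrow> 0"
    by (simp cong: filterlim_cong add: tendsto_cong)
qed

section \<open>Maximum principle for the resolvent relation\<close>

text \<open>
  The defect is \<open>o(h)\<close> when \<open>u = laplace N\<close> solves, in a discrete sense,
  \<open>2 D\<^sup>2 u + 2 \<mu> D u - (lam + \<theta>) u = - lam\<close> with \<open>D = \<theta> d/d\<theta>\<close>.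
\<close>

definition resolvent_defect :: "real \<Rightarrow> real \<Rightarrow> real measure \<Rightarrow> real \<Rightarrow> real \<Rightarrow> real" where
  "resolvent_defect lam \<mu> N \<theta> h = laplace N \<theta> - (1 - exp (- lam * h)) - exp (- (lam + \<theta>) * h) *
     (\<integral>y. laplace N (\<theta> * exp (2 * y + 2 * \<mu> * h)) \<partial>density lborel (normal_density 0 (sqrt h)))"

lemma laplace_bounds:
  assumes "real_distribution N" "AE x in N. 0 \<le> x" "0 \<le> \<theta>"
  shows "0 \<le> laplace N \<theta>" "laplace N \<theta> \<le> 1"
proof -
  interpret real_distribution N by fact
  show "0 \<le> laplace N \<theta>" by (simp add: laplace_def)
  have "laplace N \<theta> \<le> (\<integral>x. 1 \<partial>N)"
    unfolding laplace_def using assms(2,3)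
    by (intro integral_mono_AE integrable_const_bound[where B = 1]) (auto elim!: eventually_mono)
  then show "laplace N \<theta> \<le> 1" using prob_space by simp
qed

lemma borel_measurable_laplace [measurable]:
  assumes "real_distribution N"
  shows "laplace N \<in> borel_measurable borel"
proof -
  interpret real_distribution N by fact
  show ?thesis unfolding laplace_def by measurable
qed

text \<open>The source term 1 - exp (- lam h) cancels in the difference of the two defects. At a
  maximiser m of the difference \<open>w\<close>, what remains is at least w m * (1 - exp (- (lam +
  m) h)), which is of exact order h if w m > 0, while the hypotheses make it o(h).\<close>

lemma laplace_le:
  assumes N: "real_distribution N" "AE x in N. 0 < x"
    and N': "real_distribution N'" "AE x in N'. 0 < x"
    and lam: "lam > 0"
    and d: "\<And>\<theta>. \<theta> > 0 \<Longrightarrow> ((\<lambda>h. resolvent_defect lam \<mu> N \<theta> h / h) \<longlongrightarrow> 0) (at_right 0)"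
    and d': "\<And>\<theta>. \<theta> > 0 \<Longrightarrow> ((\<lambda>h. resolvent_defect lam \<mu> N' \<theta> h / h) \<longlongrightarrow> 0) (at_right 0)"
    and \<theta>: "\<theta> > 0"
  shows "laplace N \<theta> \<le> laplace N' \<theta>"
proof (rule ccontr)
  have nn: "AE x in N. 0 \<le> x" "AE x in N'. 0 \<le> x"
    using N N' by (auto elim!: eventually_mono)
  define w where "w = (\<lambda>\<theta>. laplace N \<theta> - laplace N' \<theta>)"
  assume "\<not> ?thesis"
  then have pos: "w \<theta> > 0" by (simp add: w_def)
  have w0: "w 0 = 0"
    using real_distribution.axioms(1)[OF N(1)] real_distribution.axioms(1)[OF N'(1)]
    by (simp add: w_def laplace_def prob_space.prob_space)
  have "(w \<longlongrightarrow> 0 - 0) at_top"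
    unfolding w_def using N N' by (intro tendsto_intros laplace_tendsto_0)
  then have "eventually (\<lambda>u. w u < w \<theta>) at_top"
    using pos by (simp add: order_tendstoD)
  then obtain K where K: "\<And>u. u \<ge> K \<Longrightarrow> w u < w \<theta>"
    by (auto simp: eventually_at_top_linorder)
  \<comment> \<open>The compact interval must contain \<theta>, so that its maximum is at least
    \<open>w \<theta>\<close> and hence exceeds every value beyond the interval.\<close>
  define K' where "K' = max K \<theta>"
  have "continuous_on {0..K'} w"
    unfolding w_def using N(1) N'(1) nn
    by (intro continuous_intros continuous_on_subset[OF continuous_on_laplace]) auto
  then obtain m where m: "m \<in> {0..K'}" "\<And>u. u \<in> {0..K'} \<Longrightarrow> w u \<le> w m"
    using continuous_attains_sup[of "{0..K'}" w] \<theta>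
    by (metis K'_def atLeastAtMost_iff compact_Icc empty_iff le_max_iff_disj less_imp_le order_refl)
  have wm: "w \<theta> \<le> w m" using m \<theta> by (auto simp: K'_def)
  then have m0: "m > 0" using m pos w0 by (cases "m = 0") auto
  have max: "w u \<le> w m" if "u \<ge> 0" for u
    using m(2)[of u] less_le_trans[OF K[of u] wm] that by (cases "u \<le> K'") (auto simp: K'_def max_def split: if_splits)
  let ?G = "\<lambda>h. density lborel (normal_density 0 (sqrt h))"
  have ev: "eventually (\<lambda>h::real. 0 < h) (at_right 0)"
    by (auto simp: eventually_at_right_less)
  \<comment> \<open>The Gaussian average of \<open>w\<close> is at most its maximum \<open>w m\<close>.\<close>
  have "eventually (\<lambda>h. w m * ((1 - exp (- (lam + m) * h)) / h) \<le>
    resolvent_defect lam \<mu> N m h / h - resolvent_defect lam \<mu> N' m h / h) (at_right 0)"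
    using ev
  proof eventually_elim
    case (elim h)
    interpret G: prob_space "?G h" using elim by (simp add: prob_space_normal_density)
    define p where "p = (\<lambda>y. m * exp (2 * y + 2 * \<mu> * h))"
    have pe: "m * exp (2 * y + 2 * \<mu> * h) = p y" for y by (simp add: p_def)
    have p: "p y \<ge> 0" for y using m0 by (simp add: p_def)
    have i: "integrable (?G h) (\<lambda>y. laplace L (p y))" if "real_distribution L" "AE x in L. 0 \<le> x" for L
    proof -
      note [measurable] = borel_measurable_laplace[OF that(1)]
      show ?thesis
        by (rule G.integrable_const_bound[where B = 1])
           (use laplace_bounds[OF that p] in \<open>auto simp: p_def\<close>)
    qed
    have "(\<integral>y. laplace N (p y) \<partial>?G h) - (\<integral>y. laplace N' (p y) \<partial>?G h) = (\<integral>y. w (p y) \<partial>?G h)"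
      using i[OF N(1) nn(1)] i[OF N'(1) nn(2)] by (simp add: w_def)
    also have "\<dots> \<le> (\<integral>y. w m \<partial>?G h)"
      using i[OF N(1) nn(1)] i[OF N'(1) nn(2)] max[OF p] by (intro integral_mono) (auto simp: w_def)
    also have "\<dots> = w m" using G.prob_space by simp
    finally have "exp (- (lam + m) * h) * ((\<integral>y. laplace N (p y) \<partial>?G h) - (\<integral>y. laplace N' (p y) \<partial>?G h))
       \<le> exp (- (lam + m) * h) * w m" by simp
    then have "w m * (1 - exp (- (lam + m) * h)) \<le> resolvent_defect lam \<mu> N m h - resolvent_defect lam \<mu> N' m h"
      unfolding resolvent_defect_def pe w_def by (simp add: algebra_simps)
    from divide_right_mono[OF this, of h] show ?case
      using elim by (simp add: diff_divide_distrib right_diff_distrib)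
  qed
  moreover have "((\<lambda>h. resolvent_defect lam \<mu> N m h / h - resolvent_defect lam \<mu> N' m h / h) \<longlongrightarrow> 0 - 0) (at_right 0)"
    using d d' m0 by (intro tendsto_intros) auto
  moreover have "((\<lambda>h. w m * ((1 - exp (- (lam + m) * h)) / h)) \<longlongrightarrow> w m * (lam + m)) (at_right 0)"
  proof -
    have "((\<lambda>h. (1 - exp (- (lam + m) * h)) / h) \<longlongrightarrow> lam + m) (at_right 0)"
      by real_asymp
    then show ?thesis by (intro tendsto_intros)
  qed
  ultimately have "w m * (lam + m) \<le> 0 - 0"
    by (intro tendsto_le[OF _ _ _]) (auto simp: trivial_limit_at_right_real)
  then show False using wm pos m0 lam
    by (metis add_pos_pos diff_zero less_le_trans mult_pos_pos not_le)
qed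

lemma eq_of_resolvent_defect:
  assumes N: "real_distribution N" "AE x in N. 0 < x"
    and N': "real_distribution N'" "AE x in N'. 0 < x"
    and lam: "lam > 0"
    and d: "\<And>\<theta>. \<theta> > 0 \<Longrightarrow> ((\<lambda>h. resolvent_defect lam \<mu> N \<theta> h / h) \<longlongrightarrow> 0) (at_right 0)"
    and d': "\<And>\<theta>. \<theta> > 0 \<Longrightarrow> ((\<lambda>h. resolvent_defect lam \<mu> N' \<theta> h / h) \<longlongrightarrow> 0) (at_right 0)"
  shows "N = N'"
proof (rule laplace_unique)
  show "laplace N \<theta> = laplace N' \<theta>" if "\<theta> > 0" for \<theta>
    using laplace_le[OF N N' lam d d' that] laplace_le[OF N' N lam d' d that] by simp
qed (use N N' in \<open>auto elim!: eventually_mono\<close>)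

subsection \<open>Second-order expansion of the Gaussian average\<close>

text \<open>s^n / n! is a single term of the series of exp s.\<close>

lemma power_mult_exp_neg_le:
  fixes s :: real
  assumes "0 \<le> s"
  shows "s ^ n * exp (- s) \<le> fact n"
proof -
  have "s ^ n / fact n \<le> exp s"
    using sum_le_suminf[OF summable_exp_generic[of s], of "{n}"] assms
    by (simp add: exp_def divide_inverse mult.commute)
  then show ?thesis by (simp add: exp_minus field_simps)
qed

text \<open>The remainder is uniform in s \<ge> 0, because powers of s * exp v are absorbed by the
  outer exponential. It can thus be integrated against any law on the half-line, however heavy its
  tail.\<close>

lemma exp_neg_exp_taylor:
  fixes s v :: real
  assumes "0 \<le> s"
  shows "\<bar>exp (- (s * exp v)) - exp (- s) - v * (- s * exp (- s)) - v\<^sup>2 / 2 * ((s\<^sup>2 - s) * exp (- s))\<bar> \<le> 3 * \<bar>v\<bar> ^ 3"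
proof -
  define E where "E = (\<lambda>v. s * exp v)"
  \<comment> \<open>Since E' = E, each derivative of exp (- E) is a polynomial in E times exp (-
    E).\<close>
  define d where "d = (\<lambda>(m::nat) v. if m = 0 then exp (- E v) else if m = 1 then - E v * exp (- E v)
    else if m = 2 then ((E v)\<^sup>2 - E v) * exp (- E v)
    else (- ((E v) ^ 3) + 3 * (E v)\<^sup>2 - E v) * exp (- E v))"
  have dE: "(E has_real_derivative E v) (at v)" for v
    unfolding E_def by (auto intro!: derivative_eq_intros)
  have "\<exists>t. \<bar>t\<bar> \<le> \<bar>v\<bar> \<and> exp (- E v) = (\<Sum>m<3. d m 0 / fact m * v ^ m) + d 3 t / fact 3 * v ^ 3"
  proof (rule Maclaurin_bi_le)
    show "d 0 = (\<lambda>v. exp (- E v))" by (simp add: d_def)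
    have "(d m has_real_derivative d (Suc m) t) (at t)" if "m < 3" for m t
    proof -
      have d: "d 0 = (\<lambda>v. exp (- E v))" "d 1 = (\<lambda>v. - E v * exp (- E v))"
        "d 2 = (\<lambda>v. ((E v)\<^sup>2 - E v) * exp (- E v))"
        "d 3 = (\<lambda>v. (- ((E v) ^ 3) + 3 * (E v)\<^sup>2 - E v) * exp (- E v))"
        by (simp_all add: d_def)
      have "(d 0 has_real_derivative d 1 t) (at t)" "(d 1 has_real_derivative d 2 t) (at t)"
        "(d 2 has_real_derivative d 3 t) (at t)"
        unfolding d by (auto simp: power2_eq_square power3_eq_cube algebra_simps intro!: derivative_eq_intros dE)
      moreover have "m = 0 \<or> m = 1 \<or> m = 2" using that by auto
      ultimately show ?thesis by (auto simp: numeral_2_eq_2 numeral_3_eq_3)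
    qed
    then show "\<forall>m t. m < 3 \<and> \<bar>t\<bar> \<le> \<bar>v\<bar> \<longrightarrow> (d m has_real_derivative d (Suc m) t) (at t)"
      by blast
  qed
  then obtain t where t: "exp (- E v) = (\<Sum>m<3. d m 0 / fact m * v ^ m) + d 3 t / fact 3 * v ^ 3"
    by blast
  have E0: "E t \<ge> 0" using assms by (simp add: E_def)
  have "\<bar>d 3 t\<bar> = \<bar>- ((E t) ^ 3 * exp (- E t)) + 3 * ((E t)\<^sup>2 * exp (- E t)) - (E t) ^ 1 * exp (- E t)\<bar>"
    by (simp add: d_def algebra_simps)
  also have "\<dots> \<le> (E t) ^ 3 * exp (- E t) + 3 * ((E t)\<^sup>2 * exp (- E t)) + (E t) ^ 1 * exp (- E t)"
    using E0 by (auto simp: abs_le_iff)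
  \<comment> \<open>The sum is 6 + 3 * 2 + 1 = 13, and the cubic Taylor term then has factor 13 / 6
    \<le> 3.\<close>
  also have "\<dots> \<le> fact 3 + 3 * fact 2 + fact 1"
    using E0 by (intro add_mono mult_left_mono power_mult_exp_neg_le) auto
  finally have d3: "\<bar>d 3 t\<bar> \<le> 13" by (simp add: fact_numeral)
  have sum: "(\<Sum>m<3. d m 0 / fact m * v ^ m) = exp (- s) + (- s * exp (- s)) * v + ((s\<^sup>2 - s) * exp (- s)) / 2 * v\<^sup>2"
    by (simp add: lessThan_Suc numeral_3_eq_3 d_def E_def power2_eq_square)
  have "a - b - v * p - w / 2 * q = z" if "a = b + p * v + q / 2 * w + z" for a b p q w z
    using that by simp
  from this[OF t[unfolded sum]]
  have "exp (- (s * exp v)) - exp (- s) - v * (- s * exp (- s)) - v\<^sup>2 / 2 * ((s\<^sup>2 - s) * exp (- s)) = d 3 t / 6 * v ^ 3"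
    by (simp add: E_def fact_numeral)
  also have "\<bar>\<dots>\<bar> \<le> 3 * \<bar>v\<bar> ^ 3"
    using d3 by (simp add: abs_mult power_abs mult_right_mono)
  finally show ?thesis .
qed

lemma normal_integral:
  assumes "0 < h" "f \<in> borel_measurable borel"
  shows "(\<integral>y. f y \<partial>density lborel (normal_density 0 (sqrt h))) = (\<integral>y. normal_density 0 (sqrt h) y * f y \<partial>lborel)"
    and "integrable (density lborel (normal_density 0 (sqrt h))) f \<longleftrightarrow> integrable lborel (\<lambda>y. normal_density 0 (sqrt h) y * f y)"
  using assms by (simp_all add: integral_density integrable_density)

text \<open>\<open>\<rho>1\<close> and \<open>\<rho>2\<close> are the first two derivatives of v ->
  laplace N (\<theta> exp v) at 0, that is D u and D^2 u. For v = 2 y + 2 \<mu> h with y centred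
  Gaussian of variance h, the mean of v is 2 \<mu> h, that of v^2 / 2 is 2 h + 2 \<mu>^2 h^2, and
  that of |v|^3 is of order h^(3/2).\<close>

lemma laplace_normal_expansion:
  assumes N: "real_distribution N" "AE x in N. 0 < x" and \<theta>: "0 < \<theta>"
  defines "\<rho>1 \<equiv> (\<integral>x. - (\<theta> * x) * exp (- (\<theta> * x)) \<partial>N)"
    and "\<rho>2 \<equiv> (\<integral>x. ((\<theta> * x)\<^sup>2 - \<theta> * x) * exp (- (\<theta> * x)) \<partial>N)"
  obtains K where "\<And>h. 0 < h \<Longrightarrow> h \<le> 1 \<Longrightarrow>
    \<bar>(\<integral>y. laplace N (\<theta> * exp (2 * y + 2 * \<mu> * h)) \<partial>density lborel (normal_density 0 (sqrt h)))
      - (laplace N \<theta> + 2 * \<mu> * h * \<rho>1 + (2 * h + 2 * \<mu>\<^sup>2 * h\<^sup>2) * \<rho>2)\<bar> \<le> K * (h * sqrt h)"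
proof
  fix h :: real assume h: "0 < h" "h \<le> 1"
  interpret real_distribution N by fact
  note [measurable] = borel_measurable_laplace[OF N(1)]
  define G where "G = density lborel (normal_density 0 (sqrt h))"
  interpret G: prob_space G unfolding G_def using h by (simp add: prob_space_normal_density)
  have nn: "AE x in N. 0 \<le> \<theta> * x" using N(2) \<theta> by (auto elim!: eventually_mono)
  have b: "integrable N (\<lambda>x. (\<theta> * x) ^ n * exp (- (\<theta> * x)))" for n
    by (rule integrable_const_bound[where B = "fact n"])
       (use nn in \<open>auto elim!: eventually_mono simp: abs_mult intro: power_mult_exp_neg_le\<close>)
  have i0: "integrable N (\<lambda>x. exp (- (\<theta> * x)))" using b[of 0] by simp
  have i1: "integrable N (\<lambda>x. - (\<theta> * x) * exp (- (\<theta> * x)))" using b[of 1] by simp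
  have i2: "integrable N (\<lambda>x. ((\<theta> * x)\<^sup>2 - \<theta> * x) * exp (- (\<theta> * x)))"
    using Bochner_Integration.integrable_diff[OF b[of 2] b[of 1]] by (simp add: left_diff_distrib)
  have iv: "integrable N (\<lambda>x. exp (- (\<theta> * x * exp v)))" for v
    by (rule integrable_const_bound[where B = 1])
       (use nn in \<open>auto elim!: eventually_mono\<close>)
  have lv: "laplace N (\<theta> * exp v) = (\<integral>x. exp (- (\<theta> * x * exp v)) \<partial>N)" for v
    by (simp add: laplace_def mult_ac)
  have l0: "laplace N \<theta> = (\<integral>x. exp (- (\<theta> * x)) \<partial>N)" by (simp add: laplace_def)
  have pw: "\<bar>laplace N (\<theta> * exp v) - (laplace N \<theta> + v * \<rho>1 + v\<^sup>2 / 2 * \<rho>2)\<bar> \<le> 3 * \<bar>v\<bar> ^ 3" for v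
  proof -
    have "laplace N \<theta> + v * \<rho>1 + v\<^sup>2 / 2 * \<rho>2 = (\<integral>x. exp (- (\<theta> * x)) + v * (- (\<theta> * x) * exp (- (\<theta> * x)))
       + v\<^sup>2 / 2 * (((\<theta> * x)\<^sup>2 - \<theta> * x) * exp (- (\<theta> * x))) \<partial>N)"
      unfolding l0 \<rho>1_def \<rho>2_def using i0 i1 i2 by simp
    moreover have "\<bar>(\<integral>x. exp (- (\<theta> * x * exp v)) \<partial>N) - (\<integral>x. exp (- (\<theta> * x)) + v * (- (\<theta> * x) * exp (- (\<theta> * x)))
       + v\<^sup>2 / 2 * (((\<theta> * x)\<^sup>2 - \<theta> * x) * exp (- (\<theta> * x))) \<partial>N)\<bar> \<le> 3 * \<bar>v\<bar> ^ 3"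
      using i0 i1 i2 iv nn
      by (intro integral_abs_diff_le prob_space_axioms Bochner_Integration.integrable_add integrable_mult_right)
         (auto elim!: eventually_mono dest!: exp_neg_exp_taylor[where v = v] simp: diff_diff_add)
    ultimately show ?thesis by (simp add: lv)
  qed
  have m: "integrable G (\<lambda>y. y)" "integrable G (\<lambda>y. y\<^sup>2)" "integrable G (\<lambda>y. \<bar>y\<bar> ^ 3)"
    "(\<integral>y. y \<partial>G) = 0" "(\<integral>y. y\<^sup>2 \<partial>G) = h" "(\<integral>y. \<bar>y\<bar> ^ 3 \<partial>G) = 2 * (h * sqrt h) * sqrt (2 / pi)"
    unfolding G_def using h integrable_normal_moment[of "sqrt h" 0 1] integrable_normal_moment[of "sqrt h" 0 2]
      integrable_normal_moment_abs[of "sqrt h" 0 3] integral_normal_moment_odd[of "sqrt h" 0 0]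
      integral_normal_moment_even[of "sqrt h" 0 1] integral_normal_moment_abs_odd[of "sqrt h" 0 1]
    by (simp_all add: normal_integral power3_eq_cube numeral_3_eq_3)
  let ?v = "\<lambda>y. 2 * y + 2 * \<mu> * h"
  have v3: "\<bar>?v y\<bar> ^ 3 \<le> 32 * \<bar>y\<bar> ^ 3 + 32 * \<bar>\<mu>\<bar> ^ 3 * (h * sqrt h)" for y
  proof -
    \<comment> \<open>Convexity of the cube; the difference of the two sides factors
      explicitly.\<close>
    have conv: "(p + q) ^ 3 \<le> 4 * (p ^ 3 + q ^ 3)" if "0 \<le> p" "0 \<le> q" for p q :: real
    proof -
      have "4 * (p ^ 3 + q ^ 3) - (p + q) ^ 3 = 3 * ((p + q) * (p - q)\<^sup>2)" by algebra
      moreover have "0 \<le> 3 * ((p + q) * (p - q)\<^sup>2)" using that by simp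
      ultimately show ?thesis by linarith
    qed
    have "\<bar>?v y\<bar> ^ 3 \<le> (2 * \<bar>y\<bar> + 2 * \<bar>\<mu>\<bar> * h) ^ 3"
      using h by (intro power_mono) (auto simp: abs_mult intro: order_trans[OF abs_triangle_ineq])
    also have "\<dots> \<le> 4 * ((2 * \<bar>y\<bar>) ^ 3 + (2 * \<bar>\<mu>\<bar> * h) ^ 3)"
      using h by (intro conv) auto
    also have "\<dots> = 32 * \<bar>y\<bar> ^ 3 + 32 * \<bar>\<mu>\<bar> ^ 3 * h ^ 3" by (simp add: power_mult_distrib)
    also have "h ^ 3 \<le> h * sqrt h"
    proof -
      have "h\<^sup>2 \<le> sqrt h" using h
        by (intro real_le_rsqrt) (auto simp: power_le_one_iff simp flip: power_mult intro: power_decreasing[of 1 4 h, simplified])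
      then have "h * h\<^sup>2 \<le> h * sqrt h" using h by (intro mult_left_mono) auto
      then show ?thesis by (simp add: power3_eq_cube power2_eq_square)
    qed
    finally show ?thesis by (simp add: mult_left_mono)
  qed
  have iL: "integrable G (\<lambda>y. laplace N (\<theta> * exp (?v y)))"
  proof (rule G.integrable_const_bound[where B = 1])
    have "AE x in N. 0 \<le> x" using N(2) by (auto elim!: eventually_mono)
    then show "AE y in G. norm (laplace N (\<theta> * exp (?v y))) \<le> 1"
      using laplace_bounds[OF N(1), of "\<theta> * exp (?v _)"] \<theta> by simp
  qed (simp add: G_def)
  have ip: "integrable G (\<lambda>y. laplace N \<theta> + ?v y * \<rho>1 + (?v y)\<^sup>2 / 2 * \<rho>2)"
   and ep: "(\<integral>y. laplace N \<theta> + ?v y * \<rho>1 + (?v y)\<^sup>2 / 2 * \<rho>2 \<partial>G) = laplace N \<theta> + 2 * \<mu> * h * \<rho>1 + (2 * h + 2 * \<mu>\<^sup>2 * h\<^sup>2) * \<rho>2"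
  proof -
    have *: "(\<lambda>y. laplace N \<theta> + ?v y * \<rho>1 + (?v y)\<^sup>2 / 2 * \<rho>2) =
      (\<lambda>y. (laplace N \<theta> + 2 * \<mu> * h * \<rho>1 + 2 * \<mu>\<^sup>2 * h\<^sup>2 * \<rho>2) + y * (2 * \<rho>1 + 4 * \<mu> * h * \<rho>2) + y\<^sup>2 * (2 * \<rho>2))"
      by (rule ext) (simp add: power2_eq_square algebra_simps)
    show "integrable G (\<lambda>y. laplace N \<theta> + ?v y * \<rho>1 + (?v y)\<^sup>2 / 2 * \<rho>2)"
      unfolding * using m by (intro Bochner_Integration.integrable_add integrable_mult_left) auto
    show "(\<integral>y. laplace N \<theta> + ?v y * \<rho>1 + (?v y)\<^sup>2 / 2 * \<rho>2 \<partial>G) = laplace N \<theta> + 2 * \<mu> * h * \<rho>1 + (2 * h + 2 * \<mu>\<^sup>2 * h\<^sup>2) * \<rho>2"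
      unfolding * using m G.prob_space by (simp add: algebra_simps)
  qed
  \<comment> \<open>Three times the bound \<open>v3\<close> has coefficients 3 * 32 = 96, and the
    third absolute moment of y contributes 2 * sqrt (2 / pi).\<close>
  let ?K = "192 * sqrt (2 / pi) + 96 * \<bar>\<mu>\<bar> ^ 3"
  have "\<bar>(\<integral>y. laplace N (\<theta> * exp (?v y)) \<partial>G) - (\<integral>y. laplace N \<theta> + ?v y * \<rho>1 + (?v y)\<^sup>2 / 2 * \<rho>2 \<partial>G)\<bar>
     = \<bar>\<integral>y. laplace N (\<theta> * exp (?v y)) - (laplace N \<theta> + ?v y * \<rho>1 + (?v y)\<^sup>2 / 2 * \<rho>2) \<partial>G\<bar>"
    using iL ip by simp
  also have "\<dots> \<le> (\<integral>y. \<bar>laplace N (\<theta> * exp (?v y)) - (laplace N \<theta> + ?v y * \<rho>1 + (?v y)\<^sup>2 / 2 * \<rho>2)\<bar> \<partial>G)"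
    by (rule integral_abs_bound)
  also have "\<dots> \<le> (\<integral>y. 96 * \<bar>y\<bar> ^ 3 + 96 * \<bar>\<mu>\<bar> ^ 3 * (h * sqrt h) \<partial>G)"
  proof (rule integral_mono)
    show "\<bar>laplace N (\<theta> * exp (?v y)) - (laplace N \<theta> + ?v y * \<rho>1 + (?v y)\<^sup>2 / 2 * \<rho>2)\<bar>
       \<le> 96 * \<bar>y\<bar> ^ 3 + 96 * \<bar>\<mu>\<bar> ^ 3 * (h * sqrt h)" for y
      using pw[of "?v y"] v3[of y] by linarith
  qed (use iL ip m in auto)
  also have "\<dots> = ?K * (h * sqrt h)"
    using m G.prob_space by (simp add: algebra_simps)
  finally show "\<bar>(\<integral>y. laplace N (\<theta> * exp (?v y)) \<partial>density lborel (normal_density 0 (sqrt h)))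
      - (laplace N \<theta> + 2 * \<mu> * h * \<rho>1 + (2 * h + 2 * \<mu>\<^sup>2 * h\<^sup>2) * \<rho>2)\<bar> \<le> ?K * (h * sqrt h)"
    unfolding ep unfolding G_def .
qed

text \<open>\<open>gen\<close> is the equation 2 D^2 u + 2 \<mu> D u = (lam + \<theta>) u - lam
  written as one integral against \<open>N\<close>. It cancels the terms of order h in the
  expansion, and the remainder is of order h^(3/2).\<close>

lemma resolvent_defect_tendsto_0:
  assumes N: "real_distribution N" "AE x in N. 0 < x" and \<theta>: "0 < \<theta>"
    and gen: "(\<integral>x. (lam + \<theta> + 2 * (1 + \<mu>) * (\<theta> * x) - 2 * (\<theta> * x)\<^sup>2) * exp (- (\<theta> * x)) \<partial>N) = lam"
  shows "((\<lambda>h. resolvent_defect lam \<mu> N \<theta> h / h) \<longlongrightarrow> 0) (at_right 0)"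
proof -
  interpret real_distribution N by fact
  define \<rho>0 where "\<rho>0 = laplace N \<theta>"
  define \<rho>1 where "\<rho>1 = (\<integral>x. - (\<theta> * x) * exp (- (\<theta> * x)) \<partial>N)"
  define \<rho>2 where "\<rho>2 = (\<integral>x. ((\<theta> * x)\<^sup>2 - \<theta> * x) * exp (- (\<theta> * x)) \<partial>N)"
  obtain K where K: "\<And>h. 0 < h \<Longrightarrow> h \<le> 1 \<Longrightarrow>
    \<bar>(\<integral>y. laplace N (\<theta> * exp (2 * y + 2 * \<mu> * h)) \<partial>density lborel (normal_density 0 (sqrt h)))
      - (\<rho>0 + 2 * \<mu> * h * \<rho>1 + (2 * h + 2 * \<mu>\<^sup>2 * h\<^sup>2) * \<rho>2)\<bar> \<le> K * (h * sqrt h)"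
    unfolding \<rho>0_def \<rho>1_def \<rho>2_def using laplace_normal_expansion[OF N \<theta>] by blast
  have nn: "AE x in N. 0 \<le> \<theta> * x" using N(2) \<theta> by (auto elim!: eventually_mono)
  have b: "integrable N (\<lambda>x. (\<theta> * x) ^ n * exp (- (\<theta> * x)))" for n
    by (rule integrable_const_bound[where B = "fact n"])
       (use nn in \<open>auto elim!: eventually_mono simp: abs_mult intro: power_mult_exp_neg_le\<close>)
  define J where "J = (\<lambda>n. \<integral>x. (\<theta> * x) ^ n * exp (- (\<theta> * x)) \<partial>N)"
  have "\<rho>0 = J 0" by (simp add: \<rho>0_def J_def laplace_def)
  moreover have "\<rho>1 = - J 1" by (simp add: \<rho>1_def J_def)
  moreover have "\<rho>2 = J 2 - J 1"
    using b[of 1] b[of 2] by (simp add: \<rho>2_def J_def left_diff_distrib)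
  moreover have "lam = (lam + \<theta>) * J 0 + 2 * (1 + \<mu>) * J 1 - 2 * J 2"
  proof -
    have "lam = (\<integral>x. (lam + \<theta>) * ((\<theta> * x) ^ 0 * exp (- (\<theta> * x))) + 2 * (1 + \<mu>) * ((\<theta> * x) ^ 1 * exp (- (\<theta> * x)))
      - 2 * ((\<theta> * x) ^ 2 * exp (- (\<theta> * x))) \<partial>N)"
      by (subst gen[symmetric]) (simp add: algebra_simps)
    also have "\<dots> = (lam + \<theta>) * J 0 + 2 * (1 + \<mu>) * J 1 - 2 * J 2"
      unfolding J_def using b[of 0] b[of 1] b[of 2] by simp
    finally show ?thesis .
  qed
  ultimately have rel: "2 * \<mu> * \<rho>1 + 2 * \<rho>2 = (lam + \<theta>) * \<rho>0 - lam" by (simp add: algebra_simps)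
  \<comment> \<open>This is the defect over h with the Gaussian average replaced by its expansion
    and \<open>rel\<close> inserted: an elementary function of h. The replacement costs only order
    sqrt h.\<close>
  define main where "main = (\<lambda>h. (\<rho>0 - (1 - exp (- lam * h))
    - exp (- (lam + \<theta>) * h) * (\<rho>0 + h * ((lam + \<theta>) * \<rho>0 - lam) + 2 * \<mu>\<^sup>2 * h\<^sup>2 * \<rho>2)) / h)"
  have "(main \<longlongrightarrow> 0) (at_right 0)"
  proof -
    define c where "c = lam + \<theta>"
    have "((\<lambda>h. (\<rho>0 - (1 - exp (- lam * h))
      - exp (- c * h) * (\<rho>0 + h * (c * \<rho>0 - lam) + 2 * \<mu>\<^sup>2 * h\<^sup>2 * \<rho>2)) / h) \<longlongrightarrow> 0) (at_right 0)"
      by real_asymp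
    then show ?thesis unfolding main_def c_def .
  qed
  moreover have "((\<lambda>h. resolvent_defect lam \<mu> N \<theta> h / h - main h) \<longlongrightarrow> 0) (at_right 0)"
  proof (rule Lim_null_comparison)
    show "((\<lambda>h. exp (- (lam + \<theta>) * h) * (K * sqrt h)) \<longlongrightarrow> 0) (at_right 0)"
      by (rule tendsto_eq_intros refl | simp)+
    have "eventually (\<lambda>h::real. 0 < h \<and> h \<le> 1) (at_right 0)"
      unfolding eventually_at_right_field by (rule exI[of _ 1]) auto
    then show "eventually (\<lambda>h. norm (resolvent_defect lam \<mu> N \<theta> h / h - main h) \<le> exp (- (lam + \<theta>) * h) * (K * sqrt h)) (at_right 0)"
    proof eventually_elim
      case (elim h)
      define I where "I = (\<integral>y. laplace N (\<theta> * exp (2 * y + 2 * \<mu> * h)) \<partial>density lborel (normal_density 0 (sqrt h)))"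
      define e where "e = exp (- (lam + \<theta>) * h)"
      define P where "P = \<rho>0 + 2 * \<mu> * h * \<rho>1 + (2 * h + 2 * \<mu>\<^sup>2 * h\<^sup>2) * \<rho>2"
      have P: "P = \<rho>0 + h * ((lam + \<theta>) * \<rho>0 - lam) + 2 * \<mu>\<^sup>2 * h\<^sup>2 * \<rho>2"
        unfolding P_def rel[symmetric] by (simp add: algebra_simps)
      have "resolvent_defect lam \<mu> N \<theta> h / h - main h = - (e * ((I - P) / h))"
        using elim unfolding resolvent_defect_def main_def P[symmetric] I_def[symmetric] e_def[symmetric] \<rho>0_def[symmetric]
        by (simp add: field_simps)
      moreover have le: "\<bar>(I - P) / h\<bar> \<le> K * sqrt h"
        using K[of h] elim unfolding I_def[symmetric] P_def[symmetric] by (simp add: field_simps)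
      ultimately have "norm (resolvent_defect lam \<mu> N \<theta> h / h - main h) = e * \<bar>(I - P) / h\<bar>"
        by (simp add: abs_mult e_def)
      also have "\<dots> \<le> e * (K * sqrt h)"
        using le by (rule mult_left_mono) (simp add: e_def)
      finally show ?case by (simp add: e_def)
    qed
  qed
  ultimately have "((\<lambda>h. main h + (resolvent_defect lam \<mu> N \<theta> h / h - main h)) \<longlongrightarrow> 0 + 0) (at_right 0)"
    by (intro tendsto_add)
  then show ?thesis by simp
qed

subsection \<open>The quotient of a beta and a gamma variable\<close>

text \<open>The integrand may blow up at an endpoint, as (1 - z) powr (a - 1) does at 1 for a < 1.
  Nonnegativity delivers integrability together with the value.\<close>

lemma has_bochner_integral_FTC_open:
  fixes f F :: "real \<Rightarrow> real"
  assumes "a < b" "continuous_on {a..b} F"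
    and "\<And>x. a < x \<Longrightarrow> x < b \<Longrightarrow> (F has_real_derivative f x) (at x)"
    and "\<And>x. a < x \<Longrightarrow> x < b \<Longrightarrow> isCont f x" "\<And>x. a < x \<Longrightarrow> x < b \<Longrightarrow> 0 \<le> f x"
  shows "has_bochner_integral lborel (\<lambda>x. indicator {a<..<b} x * f x) (F b - F a)"
proof -
  have A: "((F \<circ> real_of_ereal) \<longlongrightarrow> F a) (at_right (ereal a))"
    using continuous_on_Icc_at_rightD[OF assms(2,1)] by (simp add: ereal_tendsto_simps)
  have B: "((F \<circ> real_of_ereal) \<longlongrightarrow> F b) (at_left (ereal b))"
    using continuous_on_Icc_at_leftD[OF assms(2,1)] by (simp add: ereal_tendsto_simps)
  have e: "einterval (ereal a) (ereal b) = {a<..<b}" by (auto simp: einterval_def)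
  have "set_integrable lborel (einterval (ereal a) (ereal b)) f" "(LBINT x=ereal a..ereal b. f x) = F b - F a"
    using interval_integral_FTC_nonneg[of "ereal a" "ereal b" F f "F a" "F b"] assms A B by auto
  then show ?thesis
    using assms(1) by (simp add: e has_bochner_integral_iff set_integrable_def interval_lebesgue_integral_def set_lebesgue_integral_def)
qed

definition gamma_law :: "real \<Rightarrow> real measure" where
  "gamma_law b = density lborel (\<lambda>t. ennreal (indicator {0<..} t * (t powr (b - 1) * exp (- t) / Gamma b)))"

definition beta_law :: "real \<Rightarrow> real measure" where
  "beta_law a = density lborel (\<lambda>z. ennreal (indicator {0<..<1} z * (a * (1 - z) powr (a - 1))))"

definition ratio_law :: "real \<Rightarrow> real \<Rightarrow> real measure" where
  "ratio_law a b = distr (gamma_law b \<Otimes>\<^sub>M beta_law a) borel (\<lambda>(t, z). z / (2 * t))"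

lemma sets_gamma_law [measurable_cong, simp]: "sets (gamma_law b) = sets borel"
  and sets_beta_law [measurable_cong, simp]: "sets (beta_law a) = sets borel"
  and space_gamma_law [simp]: "space (gamma_law b) = UNIV"
  and space_beta_law [simp]: "space (beta_law a) = UNIV"
  by (simp_all add: gamma_law_def beta_law_def)

lemma nn_integral_eq_of_has_bochner_integral:
  assumes "has_bochner_integral M f (x::real)" "\<And>y. 0 \<le> f y"
  shows "(\<integral>\<^sup>+y. ennreal (f y) \<partial>M) = ennreal x"
  using assms by (simp add: has_bochner_integral_iff nn_integral_eq_integral)

lemma Gamma_has_bochner_integral:
  fixes s :: real
  assumes "0 < s"
  shows "has_bochner_integral lborel (\<lambda>t. indicator {0<..} t * (t powr (s - 1) * exp (- t))) (Gamma s)"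
proof (rule has_bochner_integral_nn_integral)
  have "ennreal (Gamma s) = (\<integral>\<^sup>+t. ennreal (indicator {0..} t * t powr (s - 1) / exp t) \<partial>lborel)"
    by (rule Gamma_conv_nn_integral_real[OF assms])
  also have "\<dots> = (\<integral>\<^sup>+t. ennreal (indicator {0<..} t * (t powr (s - 1) * exp (- t))) \<partial>lborel)"
    by (intro nn_integral_cong) (auto simp: indicator_def exp_minus field_simps)
  finally show "(\<integral>\<^sup>+t. ennreal (indicator {0<..} t * (t powr (s - 1) * exp (- t))) \<partial>lborel) = ennreal (Gamma s)" by simp
qed (use assms in \<open>auto simp: Gamma_real_pos less_imp_le\<close>)

lemma AE_gamma_law: "AE t in gamma_law b. 0 < t"
  unfolding gamma_law_def by (subst AE_density) (auto simp: indicator_def)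

lemma AE_beta_law: "AE z in beta_law a. 0 < z \<and> z < 1"
  unfolding beta_law_def by (subst AE_density) (auto simp: indicator_def)

lemma gamma_law_integral:
  assumes b: "0 < b" and [measurable]: "g \<in> borel_measurable borel"
  shows "integrable (gamma_law b) g \<longleftrightarrow> integrable lborel (\<lambda>t. indicator {0<..} t * (t powr (b - 1) * exp (- t) * g t))"
    and "(\<integral>t. g t \<partial>gamma_law b) = (\<integral>t. indicator {0<..} t * (t powr (b - 1) * exp (- t) * g t) \<partial>lborel) / Gamma b"
proof -
  have p: "0 < Gamma b" using b by (rule Gamma_real_pos)
  have e: "indicator {0<..} t * (t powr (b - 1) * exp (- t) / Gamma b) * g t =
      (1 / Gamma b) * (indicator {0<..} t * (t powr (b - 1) * exp (- t) * g t))" for t by simp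
  show "integrable (gamma_law b) g \<longleftrightarrow> integrable lborel (\<lambda>t. indicator {0<..} t * (t powr (b - 1) * exp (- t) * g t))"
  proof -
    have "integrable (gamma_law b) g \<longleftrightarrow> integrable lborel (\<lambda>t. (indicator {0<..} t * (t powr (b - 1) * exp (- t) / Gamma b)) *\<^sub>R g t)"
      unfolding gamma_law_def by (rule integrable_density) (use p in auto)
    then show ?thesis
      using p unfolding real_scaleR_def e integrable_mult_left_iff by simp
  qed
  show "(\<integral>t. g t \<partial>gamma_law b) = (\<integral>t. indicator {0<..} t * (t powr (b - 1) * exp (- t) * g t) \<partial>lborel) / Gamma b"
  proof -
    have "(\<integral>t. g t \<partial>gamma_law b) = (\<integral>t. (indicator {0<..} t * (t powr (b - 1) * exp (- t) / Gamma b)) *\<^sub>R g t \<partial>lborel)"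
      unfolding gamma_law_def by (rule integral_density) (use p in auto)
    then show ?thesis
      unfolding real_scaleR_def e integral_mult_right_zero by simp
  qed
qed

lemma prob_space_gamma_law:
  assumes b: "0 < b"
  shows "prob_space (gamma_law b)"
proof
  have "has_bochner_integral lborel (\<lambda>t. indicator {0<..} t * (t powr (b - 1) * exp (- t)) / Gamma b) (Gamma b / Gamma b)"
    by (intro has_bochner_integral_divide_zero Gamma_has_bochner_integral b)
  then have "(\<integral>\<^sup>+t. ennreal (indicator {0<..} t * (t powr (b - 1) * exp (- t)) / Gamma b) \<partial>lborel) = ennreal (Gamma b / Gamma b)"
    using Gamma_real_pos[OF b] by (intro nn_integral_eq_of_has_bochner_integral) (auto simp: less_imp_le)
  then show "emeasure (gamma_law b) (space (gamma_law b)) = 1"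
    using Gamma_real_pos[OF b] unfolding gamma_law_def by (simp add: emeasure_density)
qed

lemma gamma_law_mean:
  assumes b: "0 < b"
  shows "integrable (gamma_law b) (\<lambda>t. t)" "(\<integral>t. t \<partial>gamma_law b) = b"
proof -
  have e: "indicator {0<..} t * (t powr (b - 1) * exp (- t) * t) = indicator {0<..} t * (t powr ((b + 1) - 1) * exp (- t))" for t :: real
    by (auto simp: indicator_def powr_mult_base powr_diff field_simps)
  have h: "has_bochner_integral lborel (\<lambda>t. indicator {0<..} t * (t powr (b - 1) * exp (- t) * t)) (Gamma (b + 1))"
    unfolding e by (rule Gamma_has_bochner_integral) (use b in simp)
  show "integrable (gamma_law b) (\<lambda>t. t)"
    using h b by (subst gamma_law_integral) (auto simp: has_bochner_integral_iff)
  have G1: "Gamma (b + 1) = b * Gamma b"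
    using b by (intro Gamma_plus1) (auto elim!: nonpos_Ints_cases)
  have "(\<integral>t. t \<partial>gamma_law b) = b * Gamma b / Gamma b"
    using h b unfolding G1 by (subst gamma_law_integral) (auto simp: has_bochner_integral_iff)
  also have "\<dots> = b"
    using Gamma_real_pos[OF b] by (intro nonzero_mult_div_cancel_right) linarith
  finally show "(\<integral>t. t \<partial>gamma_law b) = b" .
qed

lemma prob_space_beta_law:
  assumes a: "0 < a"
  shows "prob_space (beta_law a)"
proof
  have "has_bochner_integral lborel (\<lambda>z. indicator {0<..<1} z * (a * (1 - z) powr (a - 1))) (- ((1 - 1) powr a) - - ((1 - 0) powr a))"
  proof (rule has_bochner_integral_FTC_open[where F = "\<lambda>z. - ((1 - z) powr a)"])
    show "continuous_on {0..1} (\<lambda>z. - ((1 - z) powr a))"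
      using a by (intro continuous_intros continuous_on_powr') auto
  qed (use a in \<open>auto intro!: derivative_eq_intros continuous_intros simp: powr_diff\<close>)
  then have "(\<integral>\<^sup>+z. ennreal (indicator {0<..<1} z * (a * (1 - z) powr (a - 1))) \<partial>lborel) = ennreal 1"
    using a by (intro nn_integral_eq_of_has_bochner_integral) (auto simp: less_imp_le)
  then show "emeasure (beta_law a) (space (beta_law a)) = 1"
    unfolding beta_law_def by (simp add: emeasure_density)
qed

lemma beta_law_integral:
  assumes a: "0 < a" and [measurable]: "g \<in> borel_measurable borel"
  shows "(\<integral>z. g z \<partial>beta_law a) = (\<integral>z. indicator {0<..<1} z * (a * (1 - z) powr (a - 1) * g z) \<partial>lborel)"
  unfolding beta_law_def using a by (subst integral_density) (auto simp: mult_ac)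

text \<open>Density times integrand is the derivative of - a (1 - z)^a exp (- v z), which is 0 at z
  = 1 and - a at z = 0. This is the integration by parts in z.\<close>

lemma beta_law_exp_integral:
  assumes a: "0 < a" and v: "0 \<le> v"
  shows "(\<integral>z. (a + v * (1 - z)) * exp (- (v * z)) \<partial>beta_law a) = a"
proof -
  have "has_bochner_integral lborel (\<lambda>z. indicator {0<..<1} z * (a * (1 - z) powr (a - 1) * ((a + v * (1 - z)) * exp (- (v * z)))))
    (- (a * (1 - 1) powr a * exp (- (v * 1))) - - (a * (1 - 0) powr a * exp (- (v * 0))))"
  proof (rule has_bochner_integral_FTC_open[where F = "\<lambda>z. - (a * (1 - z) powr a * exp (- (v * z)))"])
    show "continuous_on {0..1} (\<lambda>z. - (a * (1 - z) powr a * exp (- (v * z))))"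
      using a by (intro continuous_intros continuous_on_powr') auto
    fix z :: real assume z: "0 < z" "z < 1"
    have p: "(1 - z) powr a = (1 - z) powr (a - 1) * (1 - z)"
      using z by (simp add: powr_diff)
    show "((\<lambda>z. - (a * (1 - z) powr a * exp (- (v * z)))) has_real_derivative
        a * (1 - z) powr (a - 1) * ((a + v * (1 - z)) * exp (- (v * z)))) (at z)"
      using z by (auto intro!: derivative_eq_intros simp: p algebra_simps)
  qed (use a v in \<open>auto intro!: continuous_intros\<close>)
  then show ?thesis using a by (simp add: beta_law_integral has_bochner_integral_iff)
qed

text \<open>Up to the factor 1 / Gamma b, density times integrand is the derivative of
  \<open>H\<close>, which vanishes at infinity through exp (- t) and at 0 through exp (- c / t). The
  integrand changes sign, so its integrability is a hypothesis here and not a by-product.\<close>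

lemma gamma_law_parts:
  assumes b: "0 < b" and c: "0 < c"
    and i: "integrable (gamma_law b) (\<lambda>t. exp (- (c / t)) * (2 * a * (b - t + c / t) - 2 * ((b - 1) * (c / t) - c + (c / t)\<^sup>2)))"
  shows "(\<integral>t. exp (- (c / t)) * (2 * a * (b - t + c / t) - 2 * ((b - 1) * (c / t) - c + (c / t)\<^sup>2)) \<partial>gamma_law b) = 0"
proof -
  define g where "g = (\<lambda>t. exp (- (c / t)) * (2 * a * (b - t + c / t) - 2 * ((b - 1) * (c / t) - c + (c / t)\<^sup>2)))"
  define f where "f = (\<lambda>t. t powr (b - 1) * exp (- t) * g t)"
  define H where "H = (\<lambda>t. t powr b * exp (- t) * ((2 * a - 2 * (c / t)) * exp (- (c / t))))"
  have [measurable]: "g \<in> borel_measurable borel" unfolding g_def by measurable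
  have e: "einterval 0 \<infinity> = {0<..}" by (auto simp: einterval_def)
  have "(LBINT t=0..\<infinity>. f t) = 0 - 0"
  proof (rule interval_integral_FTC_integrable[where F = H])
    fix t :: real assume "0 < ereal t"
    then have t: "0 < t" by simp
    have p: "t powr b = t powr (b - 1) * t" using t by (simp add: powr_diff)
    define s where "s = c / t"
    have c': "c = s * t" using t by (simp add: s_def)
    have h1: "((\<lambda>t. t powr b * exp (- t)) has_real_derivative t powr (b - 1) * exp (- t) * (b - t)) (at t)"
      using t by (auto intro!: derivative_eq_intros simp: p algebra_simps)
    have h2: "((\<lambda>s. (2 * a - 2 * s) * exp (- s)) has_real_derivative (2 * s - 2 * a - 2) * exp (- s)) (at (c / t))"
      unfolding s_def by (auto intro!: derivative_eq_intros simp: algebra_simps)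
    have h3: "((\<lambda>t. c / t) has_real_derivative - (s / t)) (at t)"
      using t by (auto intro!: derivative_eq_intros simp: c')
    have "(H has_real_derivative f t) (at t)"
      unfolding H_def
    proof (rule DERIV_cong[OF DERIV_mult[OF h1 DERIV_chain2[OF h2 h3]]])
      show "t powr (b - 1) * exp (- t) * (b - t) * ((2 * a - 2 * (c / t)) * exp (- (c / t))) +
        (2 * s - 2 * a - 2) * exp (- s) * - (s / t) * (t powr b * exp (- t)) = f t"
        unfolding f_def g_def s_def[symmetric] p using t by (simp add: c' field_simps power2_eq_square)
    qed
    then show "(H has_vector_derivative f t) (at t)"
      by (simp add: has_real_derivative_iff_has_vector_derivative)
    show "isCont f t" unfolding f_def g_def using t by (intro continuous_intros) auto
  next
    show "set_integrable lborel (einterval 0 \<infinity>) f"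
      using i unfolding e set_integrable_def f_def g_def[symmetric]
      by (subst (asm) gamma_law_integral) (use b in auto)
    have "(H \<longlongrightarrow> 0) (at_right 0)" unfolding H_def using b c by real_asymp
    then show "((H \<circ> real_of_ereal) \<longlongrightarrow> 0) (at_right 0)"
      by (simp add: ereal_tendsto_simps zero_ereal_def)
    have "(H \<longlongrightarrow> 0) at_top" unfolding H_def by real_asymp
    then show "((H \<circ> real_of_ereal) \<longlongrightarrow> 0) (at_left \<infinity>)"
      by (simp add: ereal_tendsto_simps)
  qed simp
  then have "(\<integral>t. indicator {0<..} t * f t \<partial>lborel) = 0"
    by (simp add: interval_lebesgue_integral_def e set_lebesgue_integral_def)
  then show ?thesis
    unfolding g_def[symmetric] using b by (subst gamma_law_integral) (auto simp: f_def)
qed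

lemma AE_ratio_law:
  assumes a: "0 < a" and b: "0 < b"
  shows "AE p in gamma_law b \<Otimes>\<^sub>M beta_law a. 0 < fst p \<and> 0 < snd p \<and> snd p < 1"
proof -
  interpret G: prob_space "gamma_law b" by (rule prob_space_gamma_law[OF b])
  interpret Z: prob_space "beta_law a" by (rule prob_space_beta_law[OF a])
  interpret P: pair_prob_space "gamma_law b" "beta_law a" ..
  show ?thesis
  proof (rule P.AE_pair_measure)
    show "AE t in gamma_law b. AE z in beta_law a. 0 < fst (t, z) \<and> 0 < snd (t, z) \<and> snd (t, z) < 1"
      using AE_gamma_law
    proof eventually_elim
      case (elim t)
      show ?case using AE_beta_law by eventually_elim (use elim in auto)
    qed
  qed measurable
qed

lemma real_distribution_ratio_law:
  assumes a: "0 < a" and b: "0 < b"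
  shows "real_distribution (ratio_law a b)" "AE x in ratio_law a b. 0 < x"
proof -
  interpret G: prob_space "gamma_law b" by (rule prob_space_gamma_law[OF b])
  interpret Z: prob_space "beta_law a" by (rule prob_space_beta_law[OF a])
  interpret P: pair_prob_space "gamma_law b" "beta_law a" ..
  show "real_distribution (ratio_law a b)"
    unfolding ratio_law_def real_distribution_def real_distribution_axioms_def
    by (auto intro!: P.prob_space_distr)
  show "AE x in ratio_law a b. 0 < x"
    unfolding ratio_law_def
  proof (subst AE_distr_iff)
    show "AE p in gamma_law b \<Otimes>\<^sub>M beta_law a. 0 < (case p of (t, z) \<Rightarrow> z / (2 * t))"
      using AE_ratio_law[OF assms] by eventually_elim (simp add: case_prod_beta)
  qed auto
qed

text \<open>
  The integrand is \<open>(lam - L) exp (- \<theta> x)\<close> for \<open>lam = 2 a b\<close>, \<open>\<mu> = a - b\<close> and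
  \<open>L = 2 x\<^sup>2 d\<^sup>2/dx\<^sup>2 + (2 (1 + \<mu>) x + 1) d/dx\<close>. In the proof it is split as
  \<open>J = (J - R) + R\<close>: the first part is a total derivative in \<open>t\<close>, the second one in \<open>z\<close>.
\<close>

lemma ratio_law_generator:
  assumes a: "0 < a" and b: "0 < b" and \<theta>: "0 < \<theta>"
  shows "(\<integral>x. (2 * a * b + \<theta> + 2 * (1 + (a - b)) * (\<theta> * x) - 2 * (\<theta> * x)\<^sup>2) * exp (- (\<theta> * x)) \<partial>ratio_law a b) = 2 * a * b"
proof -
  interpret G: prob_space "gamma_law b" by (rule prob_space_gamma_law[OF b])
  interpret Z: prob_space "beta_law a" by (rule prob_space_beta_law[OF a])
  interpret P: pair_prob_space "gamma_law b" "beta_law a" ..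
  define j where "j = (\<lambda>s. (2 * a * b + \<theta> + 2 * (1 + (a - b)) * s - 2 * s\<^sup>2) * exp (- s))"
  define J where "J = (\<lambda>t z. j (\<theta> * (z / (2 * t))))"
  \<comment> \<open>This is 2 t times the integrand of \<open>beta_law_exp_integral\<close> with v =
    \<theta> / (2 t). Its average over z is 2 a t, and the gamma mean of that is 2 a b;
    \<open>R\<close> is chosen so that J - R integrates to 0 in t for each fixed z.\<close>
  define R where "R = (\<lambda>t z. 2 * t * ((a + \<theta> / (2 * t) * (1 - z)) * exp (- (\<theta> / (2 * t) * z))))"
  have [measurable]: "(\<lambda>p. J (fst p) (snd p)) \<in> borel_measurable (borel \<Otimes>\<^sub>M borel)"
    "(\<lambda>p. R (fst p) (snd p)) \<in> borel_measurable (borel \<Otimes>\<^sub>M borel)"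
    unfolding J_def j_def R_def by measurable
  \<comment> \<open>Each power of s is absorbed by exp (- s) at the price of a factorial; the 4 is 2
    * 2!.\<close>
  have bj: "\<bar>j s\<bar> \<le> \<bar>2 * a * b + \<theta>\<bar> + \<bar>2 * (1 + (a - b))\<bar> + 4" if s: "0 \<le> s" for s
  proof -
    have "j s = (2 * a * b + \<theta>) * (s ^ 0 * exp (- s)) + 2 * (1 + (a - b)) * (s ^ 1 * exp (- s)) - 2 * (s ^ 2 * exp (- s))"
      by (simp add: j_def algebra_simps)
    moreover have "\<bar>K * (s ^ n * exp (- s))\<bar> \<le> \<bar>K\<bar> * fact n" for K n
      using power_mult_exp_neg_le[OF s, of n] s by (auto simp: abs_mult intro!: mult_left_mono)
    from this[of "2 * a * b + \<theta>" 0] this[of "2 * (1 + (a - b))" 1] this[of 2 2]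
    have "\<bar>(2 * a * b + \<theta>) * (s ^ 0 * exp (- s))\<bar> \<le> \<bar>2 * a * b + \<theta>\<bar>"
      "\<bar>2 * (1 + (a - b)) * (s ^ 1 * exp (- s))\<bar> \<le> \<bar>2 * (1 + (a - b))\<bar>"
      "\<bar>2 * (s ^ 2 * exp (- s))\<bar> \<le> 4" by simp_all
    ultimately show ?thesis by linarith
  qed
  \<comment> \<open>Unlike \<open>J\<close>, the function \<open>R\<close> is unbounded in t; its
    integrability rests on the finite gamma mean.\<close>
  have bR: "\<bar>R t z\<bar> \<le> 2 * a * t + \<theta>" if "0 < t" "0 < z" "z < 1" for t z
  proof -
    have "R t z = (2 * a * t + \<theta> * (1 - z)) * exp (- (\<theta> / (2 * t) * z))"
      using that by (simp add: R_def field_simps)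
    then have "\<bar>R t z\<bar> = (2 * a * t + \<theta> * (1 - z)) * exp (- (\<theta> / (2 * t) * z))"
      using that a \<theta> by (simp add: abs_mult)
    also have "\<dots> \<le> (2 * a * t + \<theta>) * 1"
      using that a \<theta> by (intro mult_mono) auto
    finally show ?thesis by simp
  qed
  have iJ: "integrable (gamma_law b \<Otimes>\<^sub>M beta_law a) (\<lambda>p. J (fst p) (snd p))"
  proof (rule P.integrable_const_bound)
    show "AE p in gamma_law b \<Otimes>\<^sub>M beta_law a. norm (J (fst p) (snd p)) \<le> \<bar>2 * a * b + \<theta>\<bar> + \<bar>2 * (1 + (a - b))\<bar> + 4"
      using AE_ratio_law[OF a b] by eventually_elim (unfold J_def real_norm_def, rule bj, use \<theta> in simp)
  qed measurable
  have it: "integrable (gamma_law b \<Otimes>\<^sub>M beta_law a) (\<lambda>p. fst p)"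
  proof -
    have "integrable (distr (gamma_law b \<Otimes>\<^sub>M beta_law a) (gamma_law b) fst) (\<lambda>t. t)"
      unfolding Z.distr_pair_fst by (rule gamma_law_mean(1)[OF b])
    then show ?thesis by (subst (asm) integrable_distr_eq) auto
  qed
  have iR: "integrable (gamma_law b \<Otimes>\<^sub>M beta_law a) (\<lambda>p. R (fst p) (snd p))"
  proof (rule Bochner_Integration.integrable_bound)
    show "integrable (gamma_law b \<Otimes>\<^sub>M beta_law a) (\<lambda>p. 2 * a * fst p + \<theta>)"
      using it by simp
    show "AE p in gamma_law b \<Otimes>\<^sub>M beta_law a. norm (R (fst p) (snd p)) \<le> norm (2 * a * fst p + \<theta>)"
      using AE_ratio_law[OF a b] by eventually_elim (use bR in \<open>force intro: order_trans[OF _ abs_ge_self]\<close>)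
  qed measurable
  have iD: "integrable (gamma_law b \<Otimes>\<^sub>M beta_law a) (\<lambda>(t, z). J t z - R t z)"
    using Bochner_Integration.integrable_diff[OF iJ iR] by (simp add: case_prod_unfold)
  have z0: "(\<integral>t. J t z - R t z \<partial>gamma_law b) = 0" if z: "0 < z" "z < 1" for z
  proof -
    have [measurable]: "(\<lambda>t. J t z) \<in> borel_measurable borel" "(\<lambda>t. R t z) \<in> borel_measurable borel"
      unfolding J_def j_def R_def by measurable
    \<comment> \<open>For fixed z the argument \<theta> z / (2 t) equals c / t, which is the form
      required by \<open>gamma_law_parts\<close>.\<close>
    define c where "c = \<theta> * z / 2"
    have c: "c > 0" using z \<theta> by (simp add: c_def)
    define g where "g = (\<lambda>t. exp (- (c / t)) * (2 * a * (b - t + c / t) - 2 * ((b - 1) * (c / t) - c + (c / t)\<^sup>2)))"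
    have [measurable]: "g \<in> borel_measurable borel" unfolding g_def by measurable
    have eq: "J t z - R t z = g t" if t: "t > 0" for t
    proof -
      define s where "s = c / t"
      have s1: "\<theta> * (z / (2 * t)) = s" "\<theta> / (2 * t) * z = s" using t by (simp_all add: s_def c_def)
      have s2: "c = s * t" "\<theta> = 2 * t * s / z" using t z by (simp_all add: s_def c_def)
      have "J t z - R t z = exp (- s) * (2 * a * b + \<theta> + 2 * (1 + (a - b)) * s - 2 * s\<^sup>2 - (2 * t * a + \<theta> * (1 - z)))"
        unfolding J_def R_def j_def s1 using t by (simp add: field_simps)
      also have "2 * a * b + \<theta> + 2 * (1 + (a - b)) * s - 2 * s\<^sup>2 - (2 * t * a + \<theta> * (1 - z)) = 2 * a * (b - t + s) - 2 * ((b - 1) * s - c + s\<^sup>2)"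
        using z unfolding s2(1) by (subst (1 2) s2(2)) (simp add: field_simps)
      finally show ?thesis by (simp add: g_def s_def)
    qed
    have iJz: "integrable (gamma_law b) (\<lambda>t. J t z)"
    proof (rule G.integrable_const_bound)
      show "AE t in gamma_law b. norm (J t z) \<le> \<bar>2 * a * b + \<theta>\<bar> + \<bar>2 * (1 + (a - b))\<bar> + 4"
        using AE_gamma_law[of b] by eventually_elim (unfold J_def real_norm_def, rule bj, use \<theta> z in simp)
    qed measurable
    have iRz: "integrable (gamma_law b) (\<lambda>t. R t z)"
    proof (rule Bochner_Integration.integrable_bound)
      show "integrable (gamma_law b) (\<lambda>t. 2 * a * t + \<theta>)"
        using gamma_law_mean(1)[OF b] by simp
      show "AE t in gamma_law b. norm (R t z) \<le> norm (2 * a * t + \<theta>)"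
        using AE_gamma_law[of b] by eventually_elim (use bR z in \<open>force intro: order_trans[OF _ abs_ge_self]\<close>)
    qed measurable
    have AEeq: "AE t in gamma_law b. J t z - R t z = g t"
      using AE_gamma_law[of b] by eventually_elim (rule eq)
    have "integrable (gamma_law b) (\<lambda>t. J t z - R t z) \<longleftrightarrow> integrable (gamma_law b) g"
      using AEeq by (intro integrable_cong_AE) auto
    then have "integrable (gamma_law b) g" using iJz iRz by simp
    then have "(\<integral>t. g t \<partial>gamma_law b) = 0"
      unfolding g_def by (rule gamma_law_parts[OF b c])
    moreover have "(\<integral>t. J t z - R t z \<partial>gamma_law b) = (\<integral>t. g t \<partial>gamma_law b)"
      using AEeq by (intro integral_cong_AE) auto
    ultimately show ?thesis by simp
  qed
  have "(\<integral>z. (\<integral>t. J t z - R t z \<partial>gamma_law b) \<partial>beta_law a) = (\<integral>(t, z). J t z - R t z \<partial>(gamma_law b \<Otimes>\<^sub>M beta_law a))"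
    by (rule P.integral_snd[OF iD])
  moreover have "(\<integral>z. (\<integral>t. J t z - R t z \<partial>gamma_law b) \<partial>beta_law a) = (\<integral>z. 0 \<partial>beta_law a)"
  proof (rule integral_cong_AE)
    show "(\<lambda>z. \<integral>t. J t z - R t z \<partial>gamma_law b) \<in> borel_measurable (beta_law a)"
      unfolding J_def j_def R_def by measurable
    show "AE z in beta_law a. (\<integral>t. J t z - R t z \<partial>gamma_law b) = 0"
      using AE_beta_law[of a] by eventually_elim (use z0 in auto)
  qed simp
  ultimately have D: "(\<integral>p. J (fst p) (snd p) - R (fst p) (snd p) \<partial>(gamma_law b \<Otimes>\<^sub>M beta_law a)) = 0"
    by (simp add: case_prod_unfold)
  have "(\<integral>p. R (fst p) (snd p) \<partial>(gamma_law b \<Otimes>\<^sub>M beta_law a)) = (\<integral>t. (\<integral>z. R t z \<partial>beta_law a) \<partial>gamma_law b)"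
    using P.integral_fst'[OF iR] by simp
  also have "\<dots> = (\<integral>t. 2 * a * t \<partial>gamma_law b)"
  proof (rule integral_cong_AE)
    show "(\<lambda>t. \<integral>z. R t z \<partial>beta_law a) \<in> borel_measurable (gamma_law b)"
      unfolding R_def by measurable
    show "AE t in gamma_law b. (\<integral>z. R t z \<partial>beta_law a) = 2 * a * t"
      using AE_gamma_law[of b]
    proof eventually_elim
      case (elim t)
      show ?case unfolding R_def using beta_law_exp_integral[OF a, of "\<theta> / (2 * t)"] elim \<theta> by simp
    qed
  qed simp
  also have "\<dots> = 2 * a * b" using gamma_law_mean[OF b] by simp
  finally have "(\<integral>p. J (fst p) (snd p) \<partial>(gamma_law b \<Otimes>\<^sub>M beta_law a)) = 2 * a * b"
    using D iJ iR by simp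
  then show ?thesis
    unfolding ratio_law_def by (subst integral_distr) (auto simp: J_def j_def case_prod_beta)
qed

section \<open>The call payoff under the ratio law\<close>

text \<open>The payoff is (z - \<kappa>) / (2 t) on z > \<kappa> = 2 k t and 0 elsewhere. It
  vanishes altogether once \<kappa> \<ge> 1, which is the origin of the upper limit 1 / (2
  k).\<close>

lemma beta_law_call:
  assumes a: "0 < a" and k: "0 < k" and t: "0 < t"
  shows "(\<integral>\<^sup>+z. ennreal (max (z / (2 * t) - k) 0) \<partial>beta_law a)
    = ennreal (indicator {0<..<1 / (2 * k)} t * ((1 - 2 * k * t) powr (a + 1) / (2 * t * (a + 1))))"
proof -
  define \<kappa> where "\<kappa> = 2 * k * t"
  have \<kappa>: "\<kappa> > 0" using k t by (simp add: \<kappa>_def)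
  have lhs: "(\<integral>\<^sup>+z. ennreal (max (z / (2 * t) - k) 0) \<partial>beta_law a)
     = (\<integral>\<^sup>+z. ennreal (indicator {\<kappa><..<1} z * (a * (1 - z) powr (a - 1) * (z - \<kappa>) / (2 * t))) \<partial>lborel)"
    unfolding beta_law_def
  proof (subst nn_integral_density, simp, simp, intro nn_integral_cong)
    fix z :: real
    have "max (z / (2 * t) - k) 0 = (if \<kappa> < z then (z - \<kappa>) / (2 * t) else 0)"
      using t by (auto simp: \<kappa>_def max_def field_simps)
    then show "ennreal (indicator {0<..<1} z * (a * (1 - z) powr (a - 1))) * ennreal (max (z / (2 * t) - k) 0)
        = ennreal (indicator {\<kappa><..<1} z * (a * (1 - z) powr (a - 1) * (z - \<kappa>) / (2 * t)))"
      using a t \<kappa> by (auto simp: indicator_def ennreal_mult[symmetric])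
  qed
  show ?thesis
  proof (cases "\<kappa> < 1")
    case True
    \<comment> \<open>Obtained by parts from - (1 - z)^a, an antiderivative of the beta density. It
      is 0 at z = 1, and at z = \<kappa> only its second term survives.\<close>
    let ?F = "\<lambda>z. (- ((1 - z) powr a * (z - \<kappa>)) - (1 - z) powr (a + 1) / (a + 1)) / (2 * t)"
    have "has_bochner_integral lborel (\<lambda>z. indicator {\<kappa><..<1} z * (a * (1 - z) powr (a - 1) * (z - \<kappa>) / (2 * t))) (?F 1 - ?F \<kappa>)"
    proof (rule has_bochner_integral_FTC_open[OF True])
      show "continuous_on {\<kappa>..1} ?F"
        using a t by (intro continuous_intros continuous_on_powr') auto
      fix z assume z: "\<kappa> < z" "z < 1"
      have p: "(1 - z) powr a = (1 - z) powr (a - 1) * (1 - z)" "(1 - z) powr (a + 1) = (1 - z) powr (a - 1) * (1 - z) * (1 - z)"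
        using z by (simp_all add: powr_diff powr_add)
      show "(?F has_real_derivative a * (1 - z) powr (a - 1) * (z - \<kappa>) / (2 * t)) (at z)"
        using z a t by (auto intro!: derivative_eq_intros simp: p) (simp add: field_simps)
      show "isCont (\<lambda>z. a * (1 - z) powr (a - 1) * (z - \<kappa>) / (2 * t)) z"
        using z t by (intro continuous_intros) auto
    qed (use a t in auto)
    then have "(\<integral>\<^sup>+z. ennreal (indicator {\<kappa><..<1} z * (a * (1 - z) powr (a - 1) * (z - \<kappa>) / (2 * t))) \<partial>lborel) = ennreal (?F 1 - ?F \<kappa>)"
      using a t by (intro nn_integral_eq_of_has_bochner_integral) (auto simp: indicator_def)
    moreover have "t < 1 / (2 * k)" using True k by (simp add: \<kappa>_def field_simps)
    ultimately show ?thesis unfolding lhs using t a by (simp add: \<kappa>_def field_simps)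
  next
    case False
    then have "\<not> t < 1 / (2 * k)" using k by (simp add: \<kappa>_def field_simps)
    moreover have "{\<kappa><..<1} = {}" using False by auto
    ultimately show ?thesis unfolding lhs by simp
  qed
qed

text \<open>The last factor is at most 1 on the interval, so the integrand of Gamma (b - 1)
  dominates; b > 1 gives integrability of t powr (b - 2) at 0.\<close>

lemma call_weight_integrable:
  fixes a b k :: real
  assumes b: "1 < b" and k: "0 < k" and a: "0 < a"
  shows "set_integrable lborel {0<..<1 / (2 * k)} (\<lambda>t. exp (- t) * t powr (b - 2) * (1 - 2 * k * t) powr (a + 1))"
  unfolding set_integrable_def
proof (rule Bochner_Integration.integrable_bound)
  show "integrable lborel (\<lambda>t. indicator {0<..} t * (t powr ((b - 1) - 1) * exp (- t)))"
    using Gamma_has_bochner_integral[of "b - 1"] b by (simp add: has_bochner_integral_iff)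
  have "(1 - 2 * k * t) powr (a + 1) \<le> 1" if "0 < t" "t < 1 / (2 * k)" for t
    using that k a by (intro powr_le1) (auto simp: field_simps)
  then show "AE t in lborel. norm (indicator {0<..<1 / (2 * k)} t *\<^sub>R (exp (- t) * t powr (b - 2) * (1 - 2 * k * t) powr (a + 1)))
    \<le> norm (indicator {0<..} t * (t powr ((b - 1) - 1) * exp (- t)))"
    by (intro AE_I2) (auto simp: indicator_def abs_mult mult_left_le_one_le mult_right_le_one_le mult.commute)
qed measurable

text \<open>The factor 1 / (2 t (a + 1)) from the beta integral lowers the gamma exponent from b - 1
  to b - 2, and Gamma b = (b - 1) Gamma (b - 1) produces the constant. With extended nonnegative
  integrals the iterated form needs no integrability in advance.\<close>

lemma ratio_law_call:
  assumes a: "0 < a" and b: "1 < b" and k: "0 < k"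
  shows "(\<integral>\<^sup>+x. ennreal (max (x - k) 0) \<partial>ratio_law a b) = ennreal (1 / (2 * (b - 1) * (a + 1) * Gamma (b - 1)) *
    (LINT t:{0<..<1 / (2 * k)}|lborel. exp (- t) * t powr (b - 2) * (1 - 2 * k * t) powr (a + 1)))"
proof -
  have b0: "0 < b" using b by simp
  interpret G: prob_space "gamma_law b" by (rule prob_space_gamma_law[OF b0])
  interpret Z: prob_space "beta_law a" by (rule prob_space_beta_law[OF a])
  interpret P: pair_prob_space "gamma_law b" "beta_law a" ..
  let ?w = "\<lambda>t. exp (- t) * t powr (b - 2) * (1 - 2 * k * t) powr (a + 1)"
  let ?C = "1 / (2 * (b - 1) * (a + 1) * Gamma (b - 1))"
  have G1: "Gamma b = (b - 1) * Gamma (b - 1)"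
  proof -
    have "b - 1 \<notin> \<int>\<^sub>\<le>\<^sub>0" using b by (auto elim!: nonpos_Ints_cases)
    from Gamma_plus1[OF this] show ?thesis by simp
  qed
  have Gp: "Gamma (b - 1) > 0" using b by (intro Gamma_real_pos) simp
  have "(\<integral>\<^sup>+x. ennreal (max (x - k) 0) \<partial>ratio_law a b) = (\<integral>\<^sup>+p. ennreal (max (snd p / (2 * fst p) - k) 0) \<partial>(gamma_law b \<Otimes>\<^sub>M beta_law a))"
    unfolding ratio_law_def by (subst nn_integral_distr) (auto simp: case_prod_beta)
  also have "\<dots> = (\<integral>\<^sup>+t. (\<integral>\<^sup>+z. ennreal (max (z / (2 * t) - k) 0) \<partial>beta_law a) \<partial>gamma_law b)"
    by (subst Z.nn_integral_fst[symmetric]) auto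
  also have "\<dots> = (\<integral>\<^sup>+t. ennreal (indicator {0<..<1 / (2 * k)} t * ((1 - 2 * k * t) powr (a + 1) / (2 * t * (a + 1)))) \<partial>gamma_law b)"
  proof (rule nn_integral_cong_AE)
    show "AE t in gamma_law b. (\<integral>\<^sup>+z. ennreal (max (z / (2 * t) - k) 0) \<partial>beta_law a) =
      ennreal (indicator {0<..<1 / (2 * k)} t * ((1 - 2 * k * t) powr (a + 1) / (2 * t * (a + 1))))"
      using AE_gamma_law by eventually_elim (rule beta_law_call[OF a k])
  qed
  also have "\<dots> = (\<integral>\<^sup>+t. ennreal (?C * (indicator {0<..<1 / (2 * k)} t *\<^sub>R ?w t)) \<partial>lborel)"
    unfolding gamma_law_def
  proof (subst nn_integral_density, simp, simp, intro nn_integral_cong)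
    fix t :: real
    have pw: "t powr (b - 1) = t powr (b - 2) * t" if "t > 0"
      using that powr_add[of t "b - 2" 1] by simp
    show "ennreal (indicator {0<..} t * (t powr (b - 1) * exp (- t) / Gamma b)) *
        ennreal (indicator {0<..<1 / (2 * k)} t * ((1 - 2 * k * t) powr (a + 1) / (2 * t * (a + 1))))
      = ennreal (?C * (indicator {0<..<1 / (2 * k)} t *\<^sub>R ?w t))"
    proof (cases "t \<in> {0<..<1 / (2 * k)}")
      case True
      have eq: "p * t * E / (\<beta> * \<gamma>) * (Q / (2 * t * \<alpha>)) = 1 / (2 * \<beta> * \<alpha> * \<gamma>) * (E * p * Q)"
        if "\<gamma> > 0" "\<beta> > 0" "\<alpha> > 0" for p E Q \<gamma> \<beta> \<alpha>
        using that True by (simp add: field_simps)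
      have "t powr (b - 1) * exp (- t) / Gamma b * ((1 - 2 * k * t) powr (a + 1) / (2 * t * (a + 1))) = ?C * ?w t"
        using eq[OF Gp, of "b - 1" "a + 1"] a b True pw unfolding G1 by simp
      then show ?thesis
        using Gp a b True by (simp add: G1 ennreal_mult[symmetric])
    qed simp
  qed
  also have "\<dots> = ennreal (\<integral>t. ?C * (indicator {0<..<1 / (2 * k)} t *\<^sub>R ?w t) \<partial>lborel)"
    using call_weight_integrable[OF b k a] Gp a b
    by (intro nn_integral_eq_integral AE_I2) (auto simp: set_integrable_def indicator_def)
  finally show ?thesis by (simp add: set_lebesgue_integral_def)
qed

subsection \<open>The exponential functional\<close>

text \<open>Uniform continuity bounds the error of each cell by e times its length, and the errors
  add up along the cells by induction.\<close>

lemma riemann_sum_tendsto: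
  fixes g :: "real \<Rightarrow> real"
  assumes g: "continuous_on {0..t} g" and t: "0 \<le> t"
  shows "(\<lambda>n. \<Sum>i<Suc n. t / Suc n * g (i * (t / Suc n))) \<longlonglongrightarrow> integral {0..t} g"
proof (rule LIMSEQ_I)
  fix r :: real assume r: "0 < r"
  \<comment> \<open>The total error e * t stays below r; dividing by t + 1 also covers t =
    0.\<close>
  define e where "e = r / (2 * (t + 1))"
  have e: "e > 0" using r t by (simp add: e_def)
  have "uniformly_continuous_on {0..t} g"
    using g by (intro compact_uniformly_continuous) auto
  then obtain d where d: "d > 0" "\<And>x y. x \<in> {0..t} \<Longrightarrow> y \<in> {0..t} \<Longrightarrow> \<bar>y - x\<bar> < d \<Longrightarrow> \<bar>g y - g x\<bar> < e"
    using e unfolding uniformly_continuous_on_def dist_real_def by metis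
  obtain n0 :: nat where n0: "t / d < n0" using reals_Archimedean2 by blast
  show "\<exists>no. \<forall>n\<ge>no. norm ((\<Sum>i<Suc n. t / Suc n * g (i * (t / Suc n))) - integral {0..t} g) < r"
  proof (intro exI allI impI)
    fix n assume n: "n \<ge> n0"
    define \<delta> where "\<delta> = t / Suc n"
    have d0: "\<delta> \<ge> 0" using t by (simp add: \<delta>_def)
    have "t / d < Suc n" using n n0 by linarith
    then have dd: "\<delta> < d" using d(1) by (simp add: \<delta>_def field_simps)
    have le: "m * \<delta> \<le> t" if "m \<le> Suc n" for m :: nat
    proof -
      have "m * \<delta> \<le> Suc n * \<delta>" using that d0 by (intro mult_right_mono) auto
      then show ?thesis by (simp add: \<delta>_def)
    qed
    have "\<bar>integral {0..m * \<delta>} g - (\<Sum>i<m. \<delta> * g (i * \<delta>))\<bar> \<le> e * (m * \<delta>)" if "m \<le> Suc n" for m :: nat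
      using that
    proof (induction m)
      case (Suc m)
      have sub: "{m * \<delta>..Suc m * \<delta>} \<subseteq> {0..t}" using le[OF Suc.prems] d0 by auto
      have i: "g integrable_on {0..Suc m * \<delta>}"
        using le[OF Suc.prems] by (intro integrable_continuous_real continuous_on_subset[OF g]) auto
      have "integral {0..Suc m * \<delta>} g = integral {0..m * \<delta>} g + integral {m * \<delta>..Suc m * \<delta>} g"
        using d0 by (intro Henstock_Kurzweil_Integration.integral_combine[symmetric] i) (auto simp: algebra_simps)
      moreover have "\<bar>integral {m * \<delta>..Suc m * \<delta>} g - \<delta> * g (m * \<delta>)\<bar> \<le> e * \<delta>"
      proof -
        have "integral {m * \<delta>..Suc m * \<delta>} g - \<delta> * g (m * \<delta>) = integral {m * \<delta>..Suc m * \<delta>} (\<lambda>s. g s - g (m * \<delta>))"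
        proof -
          have "g integrable_on {m * \<delta>..Suc m * \<delta>}"
            by (intro integrable_continuous_real continuous_on_subset[OF g] sub)
          then show ?thesis using d0 by (subst integral_diff) (auto simp: algebra_simps)
        qed
        also have "norm \<dots> \<le> e * (Suc m * \<delta> - m * \<delta>)"
        proof (rule integral_bound)
          show "continuous_on {m * \<delta>..Suc m * \<delta>} (\<lambda>s. g s - g (m * \<delta>))"
            by (intro continuous_intros continuous_on_subset[OF g] sub)
          show "norm (g s - g (m * \<delta>)) \<le> e" if "s \<in> {m * \<delta>..Suc m * \<delta>}" for s
          proof -
            have "s \<in> {0..t}" using sub that by blast
            moreover have "m * \<delta> \<in> {m * \<delta>..Suc m * \<delta>}" using d0 by (simp add: algebra_simps)
            then have "m * \<delta> \<in> {0..t}" using sub by blast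
            moreover have "\<bar>s - m * \<delta>\<bar> < d" using that dd by (auto simp: algebra_simps)
            ultimately show ?thesis using d(2)[of "m * \<delta>" s] by simp
          qed
        qed (use d0 in \<open>simp add: algebra_simps\<close>)
        finally show ?thesis by (simp add: algebra_simps)
      qed
      ultimately show ?case using Suc by (simp add: algebra_simps)
    qed simp
    from this[of "Suc n"] have "\<bar>integral {0..t} g - (\<Sum>i<Suc n. \<delta> * g (i * \<delta>))\<bar> \<le> e * t"
      by (simp add: \<delta>_def del: sum.lessThan_Suc)
    also have "e * t < r" using r t mult_nonneg_nonneg[of r t] by (simp add: e_def field_simps add_nonneg_pos)
    finally show "norm ((\<Sum>i<Suc n. t / Suc n * g (i * (t / Suc n))) - integral {0..t} g) < r"
      by (simp add: \<delta>_def abs_minus_commute del: sum.lessThan_Suc)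
  qed
qed

text \<open>Completing the square: the exponential tilt moves the mean from 0 to c
  \<sigma>^2.\<close>

lemma normal_mgf:
  assumes "0 < \<sigma>"
  shows "has_bochner_integral lborel (\<lambda>y. normal_density 0 \<sigma> y * exp (c * y)) (exp (c\<^sup>2 * \<sigma>\<^sup>2 / 2))"
proof -
  have "has_bochner_integral lborel (\<lambda>y. exp (c\<^sup>2 * \<sigma>\<^sup>2 / 2) * normal_density (c * \<sigma>\<^sup>2) \<sigma> y) (exp (c\<^sup>2 * \<sigma>\<^sup>2 / 2) * 1)"
    using assms by (intro has_bochner_integral_mult_right) (simp add: has_bochner_integral_iff)
  moreover have "exp (c\<^sup>2 * \<sigma>\<^sup>2 / 2) * normal_density (c * \<sigma>\<^sup>2) \<sigma> y = normal_density 0 \<sigma> y * exp (c * y)" for y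
  proof -
    have "c\<^sup>2 * \<sigma>\<^sup>2 / 2 + - (y - c * \<sigma>\<^sup>2)\<^sup>2 / (2 * \<sigma>\<^sup>2) = - (y - 0)\<^sup>2 / (2 * \<sigma>\<^sup>2) + c * y"
      using assms by (simp add: field_simps power2_eq_square)
    then show ?thesis
      unfolding normal_density_def by (metis (no_types, lifting) exp_add mult.assoc mult.left_commute)
  qed
  ultimately show ?thesis by simp
qed

context brownian_motion
begin

lemma exp_functional_eq_integral:
  assumes "\<omega> \<in> space M" "0 \<le> t"
  shows "set_integrable lborel {0..t} (\<lambda>s. exp (2 * drifted B \<mu> s \<omega>))"
    and "exp_functional B \<mu> t \<omega> = integral {0..t} (\<lambda>s. exp (2 * drifted B \<mu> s \<omega>))"
    and "continuous_on {0..} (\<lambda>s. exp (2 * drifted B \<mu> s \<omega>))"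
proof -
  show c: "continuous_on {0..} (\<lambda>s. exp (2 * drifted B \<mu> s \<omega>))"
    unfolding drifted_def by (intro continuous_intros continuous_paths assms)
  show i: "set_integrable lborel {0..t} (\<lambda>s. exp (2 * drifted B \<mu> s \<omega>))"
    by (rule borel_integrable_atLeastAtMost'[OF continuous_on_subset[OF c]]) auto
  show "exp_functional B \<mu> t \<omega> = integral {0..t} (\<lambda>s. exp (2 * drifted B \<mu> s \<omega>))"
    unfolding exp_functional_def by (rule set_borel_integral_eq_integral(2)[OF i])
qed

lemma exp_functional_nonneg: "0 \<le> exp_functional B \<mu> t \<omega>"
  unfolding exp_functional_def set_lebesgue_integral_def by (rule Bochner_Integration.integral_nonneg) simp

lemma exp_functional_mono:
  assumes "\<omega> \<in> space M" "0 \<le> s" "s \<le> t"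
  shows "exp_functional B \<mu> s \<omega> \<le> exp_functional B \<mu> t \<omega>"
proof -
  have "integral {0..s} (\<lambda>s. exp (2 * drifted B \<mu> s \<omega>)) \<le> integral {0..t} (\<lambda>s. exp (2 * drifted B \<mu> s \<omega>))"
    using assms by (intro integral_subset_le integrable_continuous_real continuous_on_subset[OF exp_functional_eq_integral(3)]) auto
  then show ?thesis using assms by (simp add: exp_functional_eq_integral(2))
qed

text \<open>The continuous positive integrand has a positive minimum on the compact interval. This
  is what keeps the law of A_T from charging 0.\<close>

lemma exp_functional_pos:
  assumes "\<omega> \<in> space M" "0 < t"
  shows "0 < exp_functional B \<mu> t \<omega>"
proof -
  let ?f = "\<lambda>s. exp (2 * drifted B \<mu> s \<omega>)"
  have c: "continuous_on {0..t} ?f"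
    using assms by (intro continuous_on_subset[OF exp_functional_eq_integral(3)]) auto
  obtain x where x: "\<And>s. s \<in> {0..t} \<Longrightarrow> ?f x \<le> ?f s"
    using continuous_attains_inf[OF compact_Icc _ c] assms by force
  have "0 < integral {0..t} (\<lambda>_. ?f x)" using assms by simp
  also have "\<dots> \<le> integral {0..t} ?f"
    by (intro integral_le integrable_continuous_real c x) auto
  finally show ?thesis using assms by (simp add: exp_functional_eq_integral(2))
qed

text \<open>Joint measurability is not part of the locale, which speaks of single times. Path
  continuity supplies it, through approximation by processes that are constant between grid times;
  \<open>max 0 s\<close> avoids the unconstrained negative times.\<close>

lemma measurable_B_max: "(\<lambda>(s, \<omega>). B (max 0 s) \<omega>) \<in> borel_measurable (borel \<Otimes>\<^sub>M M)"
proof (rule borel_measurable_LIMSEQ_real)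
  \<comment> \<open>\<open>r n s\<close> is the grid point of mesh 1 / Suc n just below
    \<open>max 0 s\<close>. It takes countably many values, so measurability of each single
    \<open>B t\<close> suffices.\<close>
  define r where "r = (\<lambda>n s. real (nat \<lfloor>real (Suc n) * max 0 s\<rfloor>) / real (Suc n))"
  show "(\<lambda>p. B (r n (fst p)) (snd p)) \<in> borel_measurable (borel \<Otimes>\<^sub>M M)" for n
  proof -
    note [measurable] = random_variable_B
    show ?thesis
      unfolding r_def by (rule measurable_compose_countable[where f = "\<lambda>i p. B (real i / real (Suc n)) (snd p)"]) auto
  qed
  fix p :: "real \<times> 'a" assume "p \<in> space (borel \<Otimes>\<^sub>M M)"
  then obtain s \<omega> where p: "p = (s, \<omega>)" "\<omega> \<in> space M" by (auto simp: space_pair_measure)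
  have "(\<lambda>n. r n s) \<longlonglongrightarrow> max 0 s"
  proof (rule real_tendsto_sandwich)
    show "(\<lambda>n. max 0 s - 1 / real (Suc n)) \<longlonglongrightarrow> max 0 s"
      using tendsto_diff[OF tendsto_const LIMSEQ_Suc[OF lim_1_over_n], of "max 0 s"] by simp
    have "max 0 s - 1 / real (Suc n) \<le> r n s \<and> r n s \<le> max 0 s" for n
    proof -
      have "real (nat \<lfloor>real (Suc n) * max 0 s\<rfloor>) = of_int \<lfloor>real (Suc n) * max 0 s\<rfloor>" by simp
      moreover have "real (Suc n) * max 0 s - 1 \<le> of_int \<lfloor>real (Suc n) * max 0 s\<rfloor>"
        "of_int \<lfloor>real (Suc n) * max 0 s\<rfloor> \<le> real (Suc n) * max 0 s" by linarith+
      moreover have "m - 1 / N \<le> F / N \<and> F / N \<le> m" if "N * m - 1 \<le> F" "F \<le> N * m" "N > 0" for m N F :: real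
        using that divide_right_mono[OF that(1), of N] by (simp add: diff_divide_distrib pos_divide_le_eq mult.commute)
      ultimately show ?thesis unfolding r_def by simp
    qed
    then show "\<forall>\<^sub>F n in sequentially. max 0 s - 1 / real (Suc n) \<le> r n s"
      "\<forall>\<^sub>F n in sequentially. r n s \<le> max 0 s" by auto
  qed simp
  then have "(\<lambda>n. B (r n s) \<omega>) \<longlonglongrightarrow> B (max 0 s) \<omega>"
    by (rule continuous_on_tendsto_compose[OF continuous_paths[OF p(2)]]) (auto simp: r_def)
  then show "(\<lambda>n. B (r n (fst p)) (snd p)) \<longlonglongrightarrow> (case p of (s, \<omega>) \<Rightarrow> B (max 0 s) \<omega>)"
    by (simp add: p)
qed

lemma measurable_exp_functional: "(\<lambda>(t, \<omega>). exp_functional B \<mu> t \<omega>) \<in> borel_measurable (borel \<Otimes>\<^sub>M M)"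
proof -
  note [measurable] = measurable_B_max
  have *: "exp_functional B \<mu> t \<omega> = (\<integral>s. (if 0 \<le> s \<and> s \<le> t then exp (2 * (B (max 0 s) \<omega> + \<mu> * s)) else 0) \<partial>lborel)" for t \<omega>
    unfolding exp_functional_def set_lebesgue_integral_def drifted_def
    by (intro Bochner_Integration.integral_cong) (auto simp: max_def)
  show ?thesis unfolding * by measurable
qed

lemma distr_B:
  assumes "0 < t"
  shows "distr M borel (B t) = density lborel (normal_density 0 (sqrt t))"
proof -
  have "distr M lborel (\<lambda>\<omega>. B t \<omega> - B 0 \<omega>) = density lborel (normal_density 0 (sqrt (t - 0)))"
    using assms by (intro distributed_distr_eq_density normal_increments) auto
  moreover have "distr M lborel (\<lambda>\<omega>. B t \<omega> - B 0 \<omega>) = distr M borel (B t)"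
    by (intro distr_cong) (auto simp: B_zero)
  ultimately show ?thesis by simp
qed

lemma mgf_B:
  assumes "0 \<le> t"
  shows "integrable M (\<lambda>\<omega>. exp (c * B t \<omega>))" "expectation (\<lambda>\<omega>. exp (c * B t \<omega>)) = exp (c\<^sup>2 * t / 2)"
proof -
  have "integrable M (\<lambda>\<omega>. exp (c * B t \<omega>)) \<and> expectation (\<lambda>\<omega>. exp (c * B t \<omega>)) = exp (c\<^sup>2 * t / 2)"
  proof (cases "t = 0")
    case True
    have "integrable M (\<lambda>\<omega>. exp (c * B t \<omega>)) \<longleftrightarrow> integrable M (\<lambda>\<omega>. 1::real)"
      by (rule Bochner_Integration.integrable_cong) (auto simp: True B_zero)
    moreover have "expectation (\<lambda>\<omega>. exp (c * B t \<omega>)) = expectation (\<lambda>\<omega>. 1)"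
      by (rule Bochner_Integration.integral_cong) (auto simp: True B_zero)
    ultimately show ?thesis using True by (simp add: prob_space)
  next
    case False
    then have t: "t > 0" using assms by simp
    note [measurable] = random_variable_B[OF assms]
    have "integrable (distr M borel (B t)) (\<lambda>y. exp (c * y))" "(\<integral>y. exp (c * y) \<partial>distr M borel (B t)) = exp (c\<^sup>2 * t / 2)"
      unfolding distr_B[OF t] using normal_mgf[of "sqrt t" c] t
      by (simp_all add: integral_density integrable_density has_bochner_integral_iff)
    then show ?thesis by (simp add: integrable_distr_eq integral_distr)
  qed
  then show "integrable M (\<lambda>\<omega>. exp (c * B t \<omega>))" "expectation (\<lambda>\<omega>. exp (c * B t \<omega>)) = exp (c\<^sup>2 * t / 2)" by auto
qed

text \<open>The inequality 2 |u| \<le> \<eta> + u^2 / \<eta> reduces the first moment to the second,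
  which is explicit because exp (2 B_s) and exp (4 B_s) have means exp (2 s) and exp (8 s). The free
  \<eta> takes over the role of Cauchy-Schwarz.\<close>

lemma drifted_exp_close_1:
  assumes s: "0 \<le> s" and \<eta>: "0 < \<eta>"
  shows "integrable M (\<lambda>\<omega>. \<bar>exp (2 * drifted B \<mu> s \<omega>) - 1\<bar>)"
    and "expectation (\<lambda>\<omega>. \<bar>exp (2 * drifted B \<mu> s \<omega>) - 1\<bar>)
      \<le> (\<eta> + (exp (8 * s + 4 * \<mu> * s) - 2 * exp (2 * s + 2 * \<mu> * s) + 1) / \<eta>) / 2"
proof -
  let ?u = "\<lambda>\<omega>. exp (2 * drifted B \<mu> s \<omega>) - 1"
  have e: "exp (2 * drifted B \<mu> s \<omega>) = exp (2 * \<mu> * s) * exp (2 * B s \<omega>)" for \<omega>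
    by (simp add: drifted_def algebra_simps flip: exp_add)
  have q: "(?u \<omega>)\<^sup>2 = exp (4 * \<mu> * s) * exp (4 * B s \<omega>) - 2 * exp (2 * \<mu> * s) * exp (2 * B s \<omega>) + 1" for \<omega>
    unfolding e by (simp add: power2_eq_square algebra_simps flip: exp_add)
  have i2: "integrable M (\<lambda>\<omega>. (?u \<omega>)\<^sup>2)"
    unfolding q using mgf_B[OF s] by (intro Bochner_Integration.integrable_add Bochner_Integration.integrable_diff) auto
  have e2: "expectation (\<lambda>\<omega>. (?u \<omega>)\<^sup>2) = exp (8 * s + 4 * \<mu> * s) - 2 * exp (2 * s + 2 * \<mu> * s) + 1"
    unfolding q using mgf_B[OF s] prob_space by (simp add: exp_add)
  show i: "integrable M (\<lambda>\<omega>. \<bar>?u \<omega>\<bar>)"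
    unfolding e using mgf_B[OF s] by (intro integrable_abs Bochner_Integration.integrable_diff) auto
  have "expectation (\<lambda>\<omega>. \<bar>?u \<omega>\<bar>) \<le> expectation (\<lambda>\<omega>. (\<eta> + (?u \<omega>)\<^sup>2 / \<eta>) / 2)"
  proof (rule integral_mono)
    show "\<bar>?u \<omega>\<bar> \<le> (\<eta> + (?u \<omega>)\<^sup>2 / \<eta>) / 2" for \<omega>
    proof -
      have "\<bar>z\<bar> \<le> (\<eta> + z\<^sup>2 / \<eta>) / 2" for z
        using sum_squares_bound[of \<eta> "\<bar>z\<bar>"] \<eta> by (simp add: field_simps power2_eq_square)
      then show ?thesis .
    qed
  qed (use i i2 in auto)
  also have "\<dots> = (\<eta> + expectation (\<lambda>\<omega>. (?u \<omega>)\<^sup>2) / \<eta>) / 2"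
    using i2 prob_space by simp
  finally show "expectation (\<lambda>\<omega>. \<bar>?u \<omega>\<bar>)
      \<le> (\<eta> + (exp (8 * s + 4 * \<mu> * s) - 2 * exp (2 * s + 2 * \<mu> * s) + 1) / \<eta>) / 2"
    unfolding e2 .
qed

text \<open>A_h - h is the integral of exp (2 B_s + 2 \<mu> s) - 1 over [0,h], and by exchanging the
  integrals its mean absolute value is at most h times the largest mean of |exp (2 B_s + 2 \<mu> s)
  - 1|. Integrability of A_h falls out of the same bound.\<close>

lemma exp_functional_close:
  assumes e: "0 < e"
  shows "\<forall>\<^sub>F h in at_right 0. integrable M (\<lambda>\<omega>. exp_functional B \<mu> h \<omega>) \<and>
    expectation (\<lambda>\<omega>. \<bar>exp_functional B \<mu> h \<omega> - h\<bar>) \<le> e * h"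
proof -
  note [measurable] = measurable_B_max measurable_exp_functional
  \<comment> \<open>The previous bound with \<eta> = e. At s = 0 the second moment vanishes, so m 0
    = e / 2 < e and continuity does the rest.\<close>
  define m where "m = (\<lambda>s. (e + (exp (8 * s + 4 * \<mu> * s) - 2 * exp (2 * s + 2 * \<mu> * s) + 1) / e) / 2)"
  have "isCont m 0" unfolding m_def using e by (intro continuous_intros) auto
  then have "(m \<longlongrightarrow> m 0) (at 0)" by (simp add: isCont_def)
  moreover have "m 0 < e" using e by (simp add: m_def)
  ultimately have "\<forall>\<^sub>F s in at 0. m s < e" by (rule order_tendstoD)
  then obtain d where d: "d > 0" "\<And>s. s \<noteq> 0 \<Longrightarrow> \<bar>s\<bar> < d \<Longrightarrow> m s < e"
    by (auto simp: eventually_at dist_real_def)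
  then have me: "m s \<le> e" if "0 \<le> s" "s < d" for s
    using that \<open>m 0 < e\<close> by (cases "s = 0") (auto intro: less_imp_le)
  have "integrable M (\<lambda>\<omega>. exp_functional B \<mu> h \<omega>) \<and> expectation (\<lambda>\<omega>. \<bar>exp_functional B \<mu> h \<omega> - h\<bar>) \<le> e * h"
    if h: "0 < h" "h < d" for h
  proof -
    have mE: "(\<lambda>\<omega>. exp_functional B \<mu> h \<omega>) \<in> borel_measurable M" by measurable
    have pt: "ennreal \<bar>exp_functional B \<mu> h \<omega> - h\<bar> \<le> (\<integral>\<^sup>+s. ennreal (indicator {0..h} s * \<bar>exp (2 * (B (max 0 s) \<omega> + \<mu> * s)) - 1\<bar>) \<partial>lborel)"
      if w: "\<omega> \<in> space M" for \<omega>
    proof -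
      let ?f = "\<lambda>s. exp (2 * drifted B \<mu> s \<omega>)"
      have i: "set_integrable lborel {0..h} ?f" using exp_functional_eq_integral(1)[OF w, of h] h by simp
      have i1: "set_integrable lborel {0..h} (\<lambda>s. 1::real)"
        by (auto simp: set_integrable_def emeasure_lborel_Icc_eq intro!: integrable_real_indicator)
      have "exp_functional B \<mu> h \<omega> - h = (LINT s:{0..h}|lborel. ?f s - 1)"
        using set_integral_diff(2)[OF i i1] h by (simp add: exp_functional_def set_lebesgue_integral_def)
      also have "ennreal \<bar>\<dots>\<bar> \<le> (\<integral>\<^sup>+s. ennreal (norm (indicator {0..h} s *\<^sub>R (?f s - 1))) \<partial>lborel)"
        unfolding set_lebesgue_integral_def real_norm_def[symmetric]
        by (rule integral_norm_bound_ennreal) (use set_integral_diff(1)[OF i i1] in \<open>simp add: set_integrable_def\<close>)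
      also have "\<dots> = (\<integral>\<^sup>+s. ennreal (indicator {0..h} s * \<bar>exp (2 * (B (max 0 s) \<omega> + \<mu> * s)) - 1\<bar>) \<partial>lborel)"
        by (intro nn_integral_cong) (auto simp: drifted_def max_def indicator_def)
      finally show ?thesis .
    qed
    interpret L: pair_sigma_finite M lborel
      by (simp add: pair_sigma_finite_def sigma_finite_measure_axioms lborel.sigma_finite_measure_axioms)
    have "(\<integral>\<^sup>+\<omega>. ennreal \<bar>exp_functional B \<mu> h \<omega> - h\<bar> \<partial>M)
      \<le> (\<integral>\<^sup>+\<omega>. (\<integral>\<^sup>+s. ennreal (indicator {0..h} s * \<bar>exp (2 * (B (max 0 s) \<omega> + \<mu> * s)) - 1\<bar>) \<partial>lborel) \<partial>M)"
      by (rule nn_integral_mono) (use pt in simp)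
    also have "\<dots> = (\<integral>\<^sup>+s. (\<integral>\<^sup>+\<omega>. ennreal (indicator {0..h} s * \<bar>exp (2 * (B (max 0 s) \<omega> + \<mu> * s)) - 1\<bar>) \<partial>M) \<partial>lborel)"
      by (rule L.Fubini'[symmetric]) measurable
    also have "\<dots> \<le> (\<integral>\<^sup>+s. ennreal e * indicator {0..h} s \<partial>lborel)"
    proof (rule nn_integral_mono)
      fix s :: real
      show "(\<integral>\<^sup>+\<omega>. ennreal (indicator {0..h} s * \<bar>exp (2 * (B (max 0 s) \<omega> + \<mu> * s)) - 1\<bar>) \<partial>M) \<le> ennreal e * indicator {0..h} s"
      proof (cases "s \<in> {0..h}")
        case True
        then have s: "0 \<le> s" "s < d" using h by auto
        have "(\<integral>\<^sup>+\<omega>. ennreal \<bar>exp (2 * (B s \<omega> + \<mu> * s)) - 1\<bar> \<partial>M) = ennreal (expectation (\<lambda>\<omega>. \<bar>exp (2 * drifted B \<mu> s \<omega>) - 1\<bar>))"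
          using drifted_exp_close_1(1)[OF s(1) e] by (subst nn_integral_eq_integral) (auto simp: drifted_def)
        also have "\<dots> \<le> ennreal e"
          using drifted_exp_close_1(2)[OF s(1) e, of \<mu>] me[OF s] by (intro ennreal_leI) (simp add: m_def)
        finally show ?thesis using True by (simp add: max_def)
      qed simp
    qed
    also have "\<dots> = ennreal (e * h)"
      using h e by (subst nn_integral_cmult_indicator) (auto simp: ennreal_mult)
    finally have nn: "(\<integral>\<^sup>+\<omega>. ennreal \<bar>exp_functional B \<mu> h \<omega> - h\<bar> \<partial>M) \<le> ennreal (e * h)" .
    have i: "integrable M (\<lambda>\<omega>. exp_functional B \<mu> h \<omega> - h)"
      using mE nn by (intro integrableI_bounded) (auto simp: ennreal_less_top intro: le_less_trans)
    then have "integrable M (\<lambda>\<omega>. exp_functional B \<mu> h \<omega>)"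
      using Bochner_Integration.integrable_add[OF i, of "\<lambda>_. h"] by simp
    moreover have "ennreal (expectation (\<lambda>\<omega>. \<bar>exp_functional B \<mu> h \<omega> - h\<bar>)) \<le> ennreal (e * h)"
      using nn i by (subst nn_integral_eq_integral[symmetric]) auto
    ultimately show ?thesis using e h by (simp add: ennreal_le_iff)
  qed
  then show ?thesis
    unfolding eventually_at_right_field using d(1) by (intro exI[of _ d]) auto
qed

end

subsection \<open>The Markov property of the exponential functional\<close>

text \<open>The argument is a vector of increments, not of path values, because the joint law of the
  increments is what the locale provides; the partial sums over j < i rebuild the path at the grid
  points. \<open>Suc n\<close> cells exclude a division by 0.\<close>

definition riemann_exp :: "real \<Rightarrow> real \<Rightarrow> nat \<Rightarrow> (nat \<Rightarrow> real) \<Rightarrow> real" where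
  "riemann_exp \<mu> t n x = (\<Sum>i<Suc n. t / Suc n * exp (2 * ((\<Sum>j<i. x j) + \<mu> * (i * (t / Suc n)))))"

lemma riemann_exp_nonneg: "0 \<le> t \<Longrightarrow> 0 \<le> riemann_exp \<mu> t n x"
  unfolding riemann_exp_def by (intro sum_nonneg) auto

lemma riemann_exp_cong:
  assumes "\<And>j. j < Suc n \<Longrightarrow> x j = y j"
  shows "riemann_exp \<mu> t n x = riemann_exp \<mu> t n y"
  unfolding riemann_exp_def using assms by (auto intro!: sum.cong arg_cong[where f = exp])

lemma measurable_riemann_exp [measurable]:
  "riemann_exp \<mu> t n \<in> borel_measurable (Pi\<^sub>M {..<Suc n} (\<lambda>_. borel))"
  unfolding riemann_exp_def
  by (intro borel_measurable_sum borel_measurable_times borel_measurable_const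
      measurable_compose[OF _ borel_measurable_exp] borel_measurable_add measurable_component_singleton) auto

context brownian_motion
begin

definition incr :: "real \<Rightarrow> real \<Rightarrow> nat \<Rightarrow> nat \<Rightarrow> 'a \<Rightarrow> real" where
  "incr u t n j \<omega> = B (u + real (Suc j) * (t / Suc n)) \<omega> - B (u + real j * (t / Suc n)) \<omega>"

text \<open>The exponential functional of the path restarted at time u: with u = h it is the copy
  A'_t, with u = 0 it is A_t itself.\<close>

definition shifted_functional :: "real \<Rightarrow> real \<Rightarrow> real \<Rightarrow> 'a \<Rightarrow> real" where
  "shifted_functional \<mu> u t \<omega> = integral {0..t} (\<lambda>s. exp (2 * (B (u + s) \<omega> - B u \<omega> + \<mu> * s)))"

lemma continuous_on_shifted:
  assumes "\<omega> \<in> space M" "0 \<le> u"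
  shows "continuous_on {0..t} (\<lambda>s. exp (2 * (B (u + s) \<omega> - B u \<omega> + \<mu> * s)))"
  using assms by (intro continuous_intros continuous_on_compose2[OF continuous_paths]) auto

lemma shifted_functional_0:
  assumes "\<omega> \<in> space M" "0 \<le> t"
  shows "shifted_functional \<mu> 0 t \<omega> = exp_functional B \<mu> t \<omega>"
  using assms by (simp add: shifted_functional_def exp_functional_eq_integral drifted_def B_zero)

lemma exp_functional_split:
  assumes "\<omega> \<in> space M" "0 \<le> h" "0 \<le> t"
  shows "exp_functional B \<mu> (t + h) \<omega>
    = exp_functional B \<mu> h \<omega> + exp (2 * drifted B \<mu> h \<omega>) * shifted_functional \<mu> h t \<omega>"
proof -
  let ?f = "\<lambda>s. exp (2 * drifted B \<mu> s \<omega>)"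
  have c: "continuous_on S ?f" if "S \<subseteq> {0..}" for S
    by (rule continuous_on_subset[OF exp_functional_eq_integral(3)[OF assms(1) order_refl] that])
  have "integral {0..t + h} ?f = integral {0..h} ?f + integral {h..t + h} ?f"
    using assms by (intro Henstock_Kurzweil_Integration.integral_combine[symmetric] integrable_continuous_real c) auto
  moreover have "integral {h..t + h} ?f = integral {0..t} (\<lambda>s. ?f h * exp (2 * (B (h + s) \<omega> - B h \<omega> + \<mu> * s)))"
    using integral_shift[of 0 h t ?f] c[of "{h..t + h}"] assms
    by (simp add: o_def drifted_def algebra_simps flip: exp_add)
  ultimately show ?thesis
    using assms by (simp add: exp_functional_eq_integral shifted_functional_def)
qed

lemma riemann_exp_tendsto:
  assumes "\<omega> \<in> space M" "0 \<le> u" "0 \<le> t"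
  shows "(\<lambda>n. riemann_exp \<mu> t n (\<lambda>j. incr u t n j \<omega>)) \<longlonglongrightarrow> shifted_functional \<mu> u t \<omega>"
proof -
  have "(\<Sum>j<i. incr u t n j \<omega>) = B (u + real i * (t / Suc n)) \<omega> - B u \<omega>" for i n
    unfolding incr_def by (subst sum_lessThan_telescope) simp
  then show ?thesis
    using riemann_sum_tendsto[OF continuous_on_shifted[OF assms(1,2)] assms(3), of \<mu>]
    by (simp add: riemann_exp_def shifted_functional_def)
qed

lemma measurable_shifted_functional:
  assumes "0 \<le> u" "0 \<le> t"
  shows "shifted_functional \<mu> u t \<in> borel_measurable M"
proof (rule borel_measurable_LIMSEQ_real[OF riemann_exp_tendsto])
  show "(\<lambda>\<omega>. riemann_exp \<mu> t n (\<lambda>j. incr u t n j \<omega>)) \<in> borel_measurable M" for n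
    unfolding riemann_exp_def incr_def using assms
    by (intro borel_measurable_sum borel_measurable_times borel_measurable_const
      measurable_compose[OF _ borel_measurable_exp] borel_measurable_add borel_measurable_diff random_variable_B) auto
qed (use assms in auto)

lemma distr_increment:
  assumes "0 \<le> s" "s < t"
  shows "distr M borel (\<lambda>\<omega>. B t \<omega> - B s \<omega>) = density lborel (normal_density 0 (sqrt (t - s)))"
proof -
  have "distr M lborel (\<lambda>\<omega>. B t \<omega> - B s \<omega>) = density lborel (normal_density 0 (sqrt (t - s)))"
    using assms by (intro distributed_distr_eq_density normal_increments)
  moreover have "distr M lborel (\<lambda>\<omega>. B t \<omega> - B s \<omega>) = distr M borel (\<lambda>\<omega>. B t \<omega> - B s \<omega>)"
    by (intro distr_cong) auto
  ultimately show ?thesis by simp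
qed

text \<open>The right-hand side does not involve u. This stationarity is what allows the increments
  after h to be exchanged for those after 0.\<close>

lemma distr_incr:
  assumes u: "0 \<le> u" and t: "0 < t"
  shows "distr M (Pi\<^sub>M {..<Suc n} (\<lambda>_. borel)) (\<lambda>\<omega>. \<lambda>j\<in>{..<Suc n}. incr u t n j \<omega>)
    = Pi\<^sub>M {..<Suc n} (\<lambda>_. density lborel (normal_density 0 (sqrt (t / Suc n))))"
proof -
  define \<delta> where "\<delta> = t / Suc n"
  have \<delta>: "\<delta> > 0" using t by (simp add: \<delta>_def)
  have i: "incr u t n = (\<lambda>j \<omega>. B (u + real (Suc j) * \<delta>) \<omega> - B (u + real j * \<delta>) \<omega>)"
    by (simp add: incr_def \<delta>_def fun_eq_iff)
  have "indep_vars (\<lambda>_. borel) (incr u t n) {..<Suc n}"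
    unfolding i using u \<delta> by (intro independent_increments) auto
  moreover have "random_variable borel (incr u t n j)" for j
    unfolding i using u \<delta> by (intro borel_measurable_diff random_variable_B) auto
  ultimately have "distr M (Pi\<^sub>M {..<Suc n} (\<lambda>_. borel)) (\<lambda>\<omega>. \<lambda>j\<in>{..<Suc n}. incr u t n j \<omega>)
    = Pi\<^sub>M {..<Suc n} (\<lambda>j. distr M borel (incr u t n j))"
    using indep_vars_iff_distr_eq_PiM[where I = "{..<Suc n}" and M' = "\<lambda>_. borel" and X = "incr u t n"] by auto
  also have "\<dots> = Pi\<^sub>M {..<Suc n} (\<lambda>_. density lborel (normal_density 0 (sqrt \<delta>)))"
    unfolding i using u \<delta> by (intro PiM_cong refl, subst distr_increment) (auto simp: algebra_simps)
  finally show ?thesis unfolding \<delta>_def .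
qed

text \<open>Discrete form of the independence of B_h from the path restarted at h, with both
  marginals identified.\<close>

lemma distr_first_incr:
  assumes h: "0 < h" and t: "0 < t"
  shows "distr M (borel \<Otimes>\<^sub>M Pi\<^sub>M {..<Suc n} (\<lambda>_. borel)) (\<lambda>\<omega>. (B h \<omega>, \<lambda>j\<in>{..<Suc n}. incr h t n j \<omega>))
    = density lborel (normal_density 0 (sqrt h)) \<Otimes>\<^sub>M
      Pi\<^sub>M {..<Suc n} (\<lambda>_. density lborel (normal_density 0 (sqrt (t / Suc n))))"
proof -
  define \<delta> where "\<delta> = t / Suc n"
  have \<delta>: "\<delta> > 0" using t by (simp add: \<delta>_def)
  \<comment> \<open>An irregular grid: one long first step from 0 to h, then Suc n steps of length
    \<delta>. As B_0 = 0, the first increment is B_h.\<close>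
  define \<tau> where "\<tau> = case_nat 0 (\<lambda>i. h + real i * \<delta>)"
  define Y where "Y = (\<lambda>i \<omega>. B (\<tau> (Suc i)) \<omega> - B (\<tau> i) \<omega>)"
  define S where "S = Pi\<^sub>M {..<Suc n} (\<lambda>_. borel :: real measure)"
  have Y: "Y (Suc j) = incr h t n j" for j
    by (simp add: Y_def \<tau>_def incr_def \<delta>_def fun_eq_iff)
  \<comment> \<open>\<open>indep_var\<close> needs both variables in one type, so \<open>Y 0\<close> first appears as a vector indexed by \<open>{0}\<close>.\<close>
  have "indep_vars (\<lambda>_. borel) Y {..<Suc (Suc n)}"
    unfolding Y_def using h \<delta> by (intro independent_increments) (auto simp: \<tau>_def algebra_simps split: nat.split)
  then have "indep_var (Pi\<^sub>M {0} (\<lambda>_. borel)) (\<lambda>\<omega>. restrict (\<lambda>i. Y i \<omega>) {0})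
     (Pi\<^sub>M (Suc ` {..<Suc n}) (\<lambda>_. borel)) (\<lambda>\<omega>. restrict (\<lambda>i. Y i \<omega>) (Suc ` {..<Suc n}))"
    by (rule indep_var_restrict) auto
  then have "indep_var (Pi\<^sub>M {0} (\<lambda>_. borel)) ((\<lambda>x. x) \<circ> (\<lambda>\<omega>. restrict (\<lambda>i. Y i \<omega>) {0}))
     S ((\<lambda>x. \<lambda>j\<in>{..<Suc n}. x (Suc j)) \<circ> (\<lambda>\<omega>. restrict (\<lambda>i. Y i \<omega>) (Suc ` {..<Suc n})))"
    unfolding S_def
    by (rule indep_var_compose) (auto intro!: measurable_restrict measurable_component_singleton)
  also have "(\<lambda>x. \<lambda>j\<in>{..<Suc n}. x (Suc j)) \<circ> (\<lambda>\<omega>. restrict (\<lambda>i. Y i \<omega>) (Suc ` {..<Suc n})) = (\<lambda>\<omega>. \<lambda>j\<in>{..<Suc n}. incr h t n j \<omega>)"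
    by (auto simp: fun_eq_iff Y restrict_def)
  finally have iv: "indep_var (Pi\<^sub>M {0} (\<lambda>_. borel)) (\<lambda>\<omega>. restrict (\<lambda>i. Y i \<omega>) {0}) S (\<lambda>\<omega>. \<lambda>j\<in>{..<Suc n}. incr h t n j \<omega>)"
    by (simp only: comp_def)
  define D where "D = distr M (Pi\<^sub>M {0} (\<lambda>_. borel)) (\<lambda>\<omega>. restrict (\<lambda>i. Y i \<omega>) {0})"
  define V where "V = distr M S (\<lambda>\<omega>. \<lambda>j\<in>{..<Suc n}. incr h t n j \<omega>)"
  have rv: "random_variable (Pi\<^sub>M {0} (\<lambda>_. borel)) (\<lambda>\<omega>. restrict (\<lambda>i. Y i \<omega>) {0})"
    "random_variable S (\<lambda>\<omega>. \<lambda>j\<in>{..<Suc n}. incr h t n j \<omega>)"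
    and DV: "D \<Otimes>\<^sub>M V = distr M (Pi\<^sub>M {0} (\<lambda>_. borel) \<Otimes>\<^sub>M S) (\<lambda>\<omega>. (restrict (\<lambda>i. Y i \<omega>) {0}, \<lambda>j\<in>{..<Suc n}. incr h t n j \<omega>))"
    using iv unfolding indep_var_distribution_eq D_def V_def by auto
  interpret V: prob_space V unfolding V_def by (rule prob_space_distr[OF rv(2)])
  have sets: "sets D = sets (Pi\<^sub>M {0} (\<lambda>_. borel))" "sets V = sets S" by (simp_all add: D_def V_def)
  have m0: "(\<lambda>x. x 0) \<in> measurable (Pi\<^sub>M {0} (\<lambda>_. borel)) borel" by simp
  have Y0: "Y 0 \<omega> = B h \<omega>" if "\<omega> \<in> space M" for \<omega>
    using that by (simp add: Y_def \<tau>_def B_zero)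
  have "distr M (borel \<Otimes>\<^sub>M S) (\<lambda>\<omega>. (B h \<omega>, \<lambda>j\<in>{..<Suc n}. incr h t n j \<omega>))
    = distr (D \<Otimes>\<^sub>M V) (borel \<Otimes>\<^sub>M S) (\<lambda>(x, v). (x 0, v))"
    unfolding DV using rv m0 by (subst distr_distr) (auto simp: Y0 o_def intro!: distr_cong)
  also have "\<dots> = distr D borel (\<lambda>x. x 0) \<Otimes>\<^sub>M distr V S (\<lambda>v. v)"
    using m0 by (intro pair_measure_distr[symmetric])
      (auto simp: measurable_cong_sets[OF sets(1) refl] measurable_cong_sets[OF sets(2) refl] V_def
        intro!: prob_space_imp_sigma_finite V.prob_space_distr[unfolded V_def] distr_distr)
  also have "distr V S (\<lambda>v. v) = V" using sets(2) by (rule distr_id2[OF sym])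
  also have "distr D borel (\<lambda>x. x 0) = distr M borel (B h)"
    unfolding D_def using rv m0 by (subst distr_distr) (auto simp: o_def Y0 intro!: distr_cong)
  finally show ?thesis
    by (simp only: V_def S_def distr_B[OF h] distr_incr[OF less_imp_le[OF h] t])
qed

text \<open>
  Both functionals are limits of Riemann sums, which depend on finitely many increments only.
\<close>

lemma markov_step:
  fixes g :: "real \<Rightarrow> real \<Rightarrow> real"
  assumes h: "0 < h" and t: "0 < t"
    and g_meas [measurable]: "(\<lambda>(y, z). g y z) \<in> borel_measurable (borel \<Otimes>\<^sub>M borel)"
    and g_cont: "\<And>y. continuous_on UNIV (g y)" and g_bd: "\<And>y z. 0 \<le> z \<Longrightarrow> \<bar>g y z\<bar> \<le> C"
  shows "expectation (\<lambda>\<omega>. g (B h \<omega>) (shifted_functional \<mu> h t \<omega>))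
    = (\<integral>y. expectation (\<lambda>\<omega>. g y (exp_functional B \<mu> t \<omega>)) \<partial>density lborel (normal_density 0 (sqrt h)))"
proof -
  define G where "G = density lborel (normal_density 0 (sqrt h))"
  interpret G: prob_space G unfolding G_def using h by (simp add: prob_space_normal_density)
  define V where "V = (\<lambda>n. Pi\<^sub>M {..<Suc n} (\<lambda>_. density lborel (normal_density 0 (sqrt (t / Suc n)))))"
  define S where "S = (\<lambda>n. Pi\<^sub>M {..<Suc n} (\<lambda>_. borel :: real measure))"
  define W where "W = (\<lambda>u n \<omega>. \<lambda>j\<in>{..<Suc n}. incr u t n j \<omega>)"
  note [measurable] = random_variable_B[OF less_imp_le[OF h]]
  have sG [measurable_cong, simp]: "sets G = sets borel" by (simp add: G_def)
  have sV [measurable_cong]: "sets (V n) = sets (S n)" for n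
    unfolding V_def S_def by (intro sets_PiM_cong) auto
  have Q [measurable]: "riemann_exp \<mu> t n \<in> borel_measurable (S n)" for n
    unfolding S_def by measurable
  have W_meas [measurable]: "W u n \<in> measurable M (S n)" if "0 \<le> u" for u n
    unfolding W_def S_def incr_def using that t
    by (intro measurable_restrict borel_measurable_diff random_variable_B) auto
  \<comment> \<open>\<open>g\<close> is bounded for nonnegative second argument only, so the sign of
    the Riemann sums matters.\<close>
  have g_bd': "\<bar>g y (riemann_exp \<mu> t n x)\<bar> \<le> C" for y n x
    using t by (intro g_bd riemann_exp_nonneg) simp
  have RW: "riemann_exp \<mu> t n (W u n \<omega>) = riemann_exp \<mu> t n (\<lambda>j. incr u t n j \<omega>)" for u n \<omega>
    unfolding W_def by (rule riemann_exp_cong) simp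
  have lim: "(\<lambda>n. riemann_exp \<mu> t n (W u n \<omega>)) \<longlonglongrightarrow> shifted_functional \<mu> u t \<omega>" if "\<omega> \<in> space M" "0 \<le> u" for u \<omega>
    unfolding RW using that t by (intro riemann_exp_tendsto) auto
  have g_lim: "(\<lambda>n. g y (X n)) \<longlonglongrightarrow> g y x" if "X \<longlonglongrightarrow> x" for X :: "nat \<Rightarrow> real" and x y
    by (rule continuous_on_tendsto_compose[OF g_cont that]) auto
  have A0: "shifted_functional \<mu> 0 t \<omega> = exp_functional B \<mu> t \<omega>" if "\<omega> \<in> space M" for \<omega>
    using that t by (intro shifted_functional_0) auto
  have [measurable]: "shifted_functional \<mu> h t \<in> borel_measurable M"
    using h t by (intro measurable_shifted_functional) auto
  have Am [measurable]: "exp_functional B \<mu> t \<in> borel_measurable M"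
    using measurable_compose_rev[OF measurable_exp_functional, of "\<lambda>\<omega>. (t, \<omega>)"] by simp
  \<comment> \<open>For Riemann sums the identity is exact: the joint law of B_h and the later
    increments is a product, and its second factor is also the law of the increments starting at
    0.\<close>
  have grid: "expectation (\<lambda>\<omega>. g (B h \<omega>) (riemann_exp \<mu> t n (W h n \<omega>)))
      = (\<integral>y. expectation (\<lambda>\<omega>. g y (riemann_exp \<mu> t n (W 0 n \<omega>))) \<partial>G)" for n
  proof -
    interpret N: prob_space "density lborel (normal_density 0 (sqrt (t / Suc n)))"
      using t by (intro prob_space_normal_density) simp
    interpret V: prob_space "V n"
      unfolding V_def by (rule prob_space_PiM) (rule N.prob_space_axioms)
    interpret P: pair_prob_space G "V n" ..
    have "expectation (\<lambda>\<omega>. g (B h \<omega>) (riemann_exp \<mu> t n (W h n \<omega>)))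
       = (\<integral>p. g (fst p) (riemann_exp \<mu> t n (snd p)) \<partial>distr M (borel \<Otimes>\<^sub>M S n) (\<lambda>\<omega>. (B h \<omega>, W h n \<omega>)))"
      using W_meas[of h n] h by (subst integral_distr) auto
    also have "distr M (borel \<Otimes>\<^sub>M S n) (\<lambda>\<omega>. (B h \<omega>, W h n \<omega>)) = G \<Otimes>\<^sub>M V n"
      unfolding G_def V_def S_def W_def by (rule distr_first_incr[OF h t])
    also have "(\<integral>p. g (fst p) (riemann_exp \<mu> t n (snd p)) \<partial>(G \<Otimes>\<^sub>M V n)) = (\<integral>y. (\<integral>v. g y (riemann_exp \<mu> t n v) \<partial>V n) \<partial>G)"
      by (subst P.integral_fst'[symmetric]) (auto intro!: P.integrable_const_bound[where B = C] g_bd')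
    also have "\<dots> = (\<integral>y. expectation (\<lambda>\<omega>. g y (riemann_exp \<mu> t n (W 0 n \<omega>))) \<partial>G)"
    proof (rule Bochner_Integration.integral_cong)
      fix y
      have "V n = distr M (S n) (W 0 n)"
        unfolding V_def S_def W_def using distr_incr[OF order_refl t] by simp
      then show "(\<integral>v. g y (riemann_exp \<mu> t n v) \<partial>V n) = expectation (\<lambda>\<omega>. g y (riemann_exp \<mu> t n (W 0 n \<omega>)))"
        using W_meas[of 0 n] by (simp add: integral_distr)
    qed simp
    finally show ?thesis .
  qed
  \<comment> \<open>Passage to the limit on both sides, with the constant \<open>C\<close>
    dominating throughout: on the right first inside, for fixed y, and then under the Gaussian
    law.\<close>
  have "(\<lambda>n. expectation (\<lambda>\<omega>. g (B h \<omega>) (riemann_exp \<mu> t n (W h n \<omega>)))) \<longlonglongrightarrow> expectation (\<lambda>\<omega>. g (B h \<omega>) (shifted_functional \<mu> h t \<omega>))"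
    using W_meas[of h] h
    by (intro integral_dominated_convergence[where w = "\<lambda>_. C"] AE_I2 g_lim lim) (auto simp: g_bd')
  moreover have "(\<lambda>n. \<integral>y. expectation (\<lambda>\<omega>. g y (riemann_exp \<mu> t n (W 0 n \<omega>))) \<partial>G)
     \<longlonglongrightarrow> (\<integral>y. expectation (\<lambda>\<omega>. g y (exp_functional B \<mu> t \<omega>)) \<partial>G)"
  proof (rule integral_dominated_convergence[where w = "\<lambda>_. C"])
    have inner: "(\<lambda>n. expectation (\<lambda>\<omega>. g y (riemann_exp \<mu> t n (W 0 n \<omega>)))) \<longlonglongrightarrow> expectation (\<lambda>\<omega>. g y (exp_functional B \<mu> t \<omega>))" for y
      using W_meas[of 0] lim[of _ 0] A0
      by (intro integral_dominated_convergence[where w = "\<lambda>_. C"] AE_I2 g_lim) (auto simp: g_bd')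
    then show "AE y in G. (\<lambda>n. expectation (\<lambda>\<omega>. g y (riemann_exp \<mu> t n (W 0 n \<omega>)))) \<longlonglongrightarrow> expectation (\<lambda>\<omega>. g y (exp_functional B \<mu> t \<omega>))"
      by simp
    show "(\<lambda>y. expectation (\<lambda>\<omega>. g y (exp_functional B \<mu> t \<omega>))) \<in> borel_measurable G" by measurable
    show "(\<lambda>y. expectation (\<lambda>\<omega>. g y (riemann_exp \<mu> t n (W 0 n \<omega>)))) \<in> borel_measurable G" for n
      using W_meas[of 0 n] by measurable
    show "AE y in G. norm (expectation (\<lambda>\<omega>. g y (riemann_exp \<mu> t n (W 0 n \<omega>)))) \<le> C" for n
    proof (rule AE_I2)
      fix y
      have "integrable M (\<lambda>\<omega>. g y (riemann_exp \<mu> t n (W 0 n \<omega>)))"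
        using W_meas[of 0 n] by (intro integrable_const_bound[where B = C]) (auto simp: g_bd')
      then show "norm (expectation (\<lambda>\<omega>. g y (riemann_exp \<mu> t n (W 0 n \<omega>)))) \<le> C"
        using integral_abs_diff_le[OF prob_space_axioms, of _ "\<lambda>_. 0" C] g_bd' by simp
    qed
  qed simp
  ultimately show ?thesis
    unfolding grid G_def[symmetric] by (rule LIMSEQ_unique)
qed

end

subsection \<open>The exponential functional at an independent exponential time\<close>

text \<open>Beyond h the exponential density reproduces itself up to the factor exp (- lam h). This
  is the splitting of T at time h.\<close>

lemma exponential_memoryless:
  fixes f :: "real \<Rightarrow> real"
  assumes lam: "0 < lam" and h: "0 \<le> h" and [measurable]: "f \<in> borel_measurable borel" and C: "\<And>t. \<bar>f t\<bar> \<le> C"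
  defines "E \<equiv> density lborel (exponential_density lam)"
  shows "(\<integral>t. f t \<partial>E) = (\<integral>t. indicator {..<h} t * f t \<partial>E) + exp (- lam * h) * (\<integral>t. f (t + h) \<partial>E)"
proof -
  interpret prob_space E unfolding E_def by (rule prob_space_exponential_density[OF lam])
  have [measurable_cong]: "sets E = sets borel" by (simp add: E_def)
  have d: "(\<integral>t. g t \<partial>E) = (\<integral>t. exponential_density lam t * g t \<partial>lborel)"
    if [measurable]: "g \<in> borel_measurable borel" for g :: "real \<Rightarrow> real"
    unfolding E_def by (subst integral_density) (auto simp: exponential_density_nonneg[OF lam])
  have C0: "0 \<le> C" using C[of 0] by linarith
  have i: "integrable E (\<lambda>t. indicator S t * f t)" if [measurable]: "S \<in> sets borel" for S
    using C C0 by (intro integrable_const_bound[where B = C]) (auto simp: indicator_def)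
  have "(\<integral>t. f t \<partial>E) = (\<integral>t. indicator {..<h} t * f t + indicator {h..} t * f t \<partial>E)"
    by (intro Bochner_Integration.integral_cong) (auto simp: indicator_def)
  also have "\<dots> = (\<integral>t. indicator {..<h} t * f t \<partial>E) + (\<integral>t. indicator {h..} t * f t \<partial>E)"
    by (intro Bochner_Integration.integral_add i) auto
  also have "(\<integral>t. indicator {h..} t * f t \<partial>E) = (\<integral>t. exponential_density lam t * (indicator {h..} t * f t) \<partial>lborel)"
    by (rule d) measurable
  also have "\<dots> = (\<integral>t. exponential_density lam (h + 1 * t) * (indicator {h..} (h + 1 * t) * f (h + 1 * t)) \<partial>lborel)"
    by (subst lborel_integral_real_affine[where c = 1 and t = h]) auto
  also have "\<dots> = (\<integral>t. exp (- lam * h) * (exponential_density lam t * f (t + h)) \<partial>lborel)"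
  proof (intro Bochner_Integration.integral_cong refl)
    fix t :: real
    have "exponential_density lam (h + 1 * t) = exp (- lam * h) * exponential_density lam t" if "0 \<le> t"
      using that h by (simp add: exponential_density_def algebra_simps flip: exp_add)
    then show "exponential_density lam (h + 1 * t) * (indicator {h..} (h + 1 * t) * f (h + 1 * t))
        = exp (- lam * h) * (exponential_density lam t * f (t + h))"
      by (cases "0 \<le> t") (auto simp: exponential_density_def[of lam t] add.commute)
  qed
  also have "\<dots> = exp (- lam * h) * (\<integral>t. f (t + h) \<partial>E)"
    by (subst d) auto
  finally show ?thesis .
qed

lemma abs_exp_neg_diff_le:
  fixes x y :: real
  assumes "0 \<le> x" "0 \<le> y"
  shows "\<bar>exp (- x) - exp (- y)\<bar> \<le> \<bar>x - y\<bar>"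
proof -
  have *: "exp (- u) - exp (- v) \<le> v - u" if "0 \<le> u" "u \<le> v" for u v :: real
  proof -
    have "1 - exp (u - v) \<le> v - u" using exp_ge_add_one_self[of "u - v"] by linarith
    then have "exp (- u) * (1 - exp (u - v)) \<le> 1 * (v - u)"
      using that by (intro mult_mono) auto
    then show ?thesis by (simp add: algebra_simps flip: exp_add)
  qed
  show ?thesis
    using *[of x y] *[of y x] assms by (cases "x \<le> y") auto
qed

context brownian_motion
begin

lemma measurable_exp_functional_compose [measurable (raw)]:
  assumes "f \<in> borel_measurable N" "g \<in> measurable N M"
  shows "(\<lambda>x. exp_functional B \<mu> (f x) (g x)) \<in> borel_measurable N"
  using measurable_compose[OF measurable_Pair[OF assms] measurable_exp_functional] by simp

definition stopped_law :: "real \<Rightarrow> real \<Rightarrow> real measure" where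
  "stopped_law lam \<mu> = distr (density lborel (exponential_density lam) \<Otimes>\<^sub>M M) borel
     (\<lambda>(t, \<omega>). exp_functional B \<mu> t \<omega>)"

definition phi :: "real \<Rightarrow> real \<Rightarrow> real \<Rightarrow> real" where
  "phi \<mu> t \<theta> = expectation (\<lambda>\<omega>. exp (- \<theta> * exp_functional B \<mu> t \<omega>))"

lemma measurable_phi [measurable (raw)]:
  assumes [measurable]: "f \<in> borel_measurable N" "g \<in> borel_measurable N"
  shows "(\<lambda>x. phi \<mu> (f x) (g x)) \<in> borel_measurable N"
  unfolding phi_def by measurable

lemma exp_exp_functional_integrable:
  assumes "0 \<le> \<theta>"
  shows "integrable M (\<lambda>\<omega>. exp (- \<theta> * exp_functional B \<mu> t \<omega>))"
  using assms exp_functional_nonneg by (intro integrable_const_bound[where B = 1]) auto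

lemma phi_bounds:
  assumes "0 \<le> \<theta>"
  shows "0 \<le> phi \<mu> t \<theta>" "phi \<mu> t \<theta> \<le> 1"
proof -
  show "0 \<le> phi \<mu> t \<theta>" by (simp add: phi_def)
  have "phi \<mu> t \<theta> \<le> expectation (\<lambda>\<omega>. 1)"
    unfolding phi_def using assms exp_functional_nonneg
    by (intro integral_mono exp_exp_functional_integrable) auto
  then show "phi \<mu> t \<theta> \<le> 1" by (simp add: prob_space)
qed

lemma AE_exponential: "AE t in density lborel (exponential_density lam). 0 < t"
proof (subst AE_density)
  \<comment> \<open>The density can be positive at 0 as well, so 0 is discarded as a null set; A_0 =
    0 would violate strict positivity.\<close>
  have "AE t in lborel. t \<noteq> (0::real)" by (rule AE_lborel_singleton)
  then show "AE t in lborel. 0 < ennreal (exponential_density lam t) \<longrightarrow> 0 < t"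
    by eventually_elim (auto simp: exponential_density_def)
qed simp

lemma real_distribution_stopped_law:
  assumes lam: "0 < lam"
  shows "real_distribution (stopped_law lam \<mu>)" "AE x in stopped_law lam \<mu>. 0 < x"
proof -
  let ?E = "density lborel (exponential_density lam)"
  interpret E: prob_space ?E by (rule prob_space_exponential_density[OF lam])
  interpret P: pair_prob_space ?E M ..
  show "real_distribution (stopped_law lam \<mu>)"
    unfolding stopped_law_def real_distribution_def real_distribution_axioms_def
    by (auto intro!: P.prob_space_distr)
  have "AE p in ?E \<Otimes>\<^sub>M M. 0 < exp_functional B \<mu> (fst p) (snd p)"
  proof (rule P.AE_pair_measure)
    show "AE t in ?E. AE \<omega> in M. 0 < exp_functional B \<mu> (fst (t, \<omega>)) (snd (t, \<omega>))"
      using AE_exponential by eventually_elim (auto intro!: AE_I2 exp_functional_pos)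
  qed measurable
  then show "AE x in stopped_law lam \<mu>. 0 < x"
    unfolding stopped_law_def by (subst AE_distr_iff) (auto simp: case_prod_unfold)
qed

lemma laplace_stopped_law:
  assumes lam: "0 < lam" and \<theta>: "0 \<le> \<theta>"
  shows "laplace (stopped_law lam \<mu>) \<theta> = (\<integral>t. phi \<mu> t \<theta> \<partial>density lborel (exponential_density lam))"
proof -
  let ?E = "density lborel (exponential_density lam)"
  interpret E: prob_space ?E by (rule prob_space_exponential_density[OF lam])
  interpret P: pair_prob_space ?E M ..
  have "laplace (stopped_law lam \<mu>) \<theta> = (\<integral>p. exp (- \<theta> * exp_functional B \<mu> (fst p) (snd p)) \<partial>(?E \<Otimes>\<^sub>M M))"
    unfolding laplace_def stopped_law_def by (subst integral_distr) (auto simp: case_prod_unfold)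
  also have "\<dots> = (\<integral>t. phi \<mu> t \<theta> \<partial>?E)"
    unfolding phi_def using \<theta> exp_functional_nonneg
    by (subst P.integral_fst'[symmetric]) (auto intro!: P.integrable_const_bound[where B = 1])
  finally show ?thesis .
qed

text \<open>A_h and B_h are dependent, so the factor exp (- \<theta> A_h) cannot be averaged
  separately. Replacing it by the constant exp (- \<theta> h) decouples them and costs at most
  \<theta> E |A_h - h|, since exp (- x) is 1-Lipschitz on x \<ge> 0 and the other factor lies in
  [0,1].\<close>

lemma phi_shift:
  assumes h: "0 < h" and t: "0 < t" and \<theta>: "0 < \<theta>"
    and i: "integrable M (\<lambda>\<omega>. exp_functional B \<mu> h \<omega>)"
    and e: "expectation (\<lambda>\<omega>. \<bar>exp_functional B \<mu> h \<omega> - h\<bar>) \<le> c"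
  shows "\<bar>phi \<mu> (t + h) \<theta> - exp (- \<theta> * h) *
    (\<integral>y. phi \<mu> t (\<theta> * exp (2 * y + 2 * \<mu> * h)) \<partial>density lborel (normal_density 0 (sqrt h)))\<bar> \<le> \<theta> * c"
proof -
  define g where "g = (\<lambda>y z. exp (- (\<theta> * exp (2 * y + 2 * \<mu> * h)) * z))"
  let ?g = "\<lambda>\<omega>. g (B h \<omega>) (shifted_functional \<mu> h t \<omega>)"
  note [measurable] = random_variable_B[OF less_imp_le[OF h]]
    measurable_shifted_functional[OF less_imp_le[OF h] less_imp_le[OF t]]
  have sn: "0 \<le> shifted_functional \<mu> h t \<omega>" if "\<omega> \<in> space M" for \<omega>
    unfolding shifted_functional_def using continuous_on_shifted[OF that less_imp_le[OF h]]
    by (intro Henstock_Kurzweil_Integration.integral_nonneg integrable_continuous_real) auto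
  have g01: "0 \<le> g y z" "0 \<le> z \<Longrightarrow> g y z \<le> 1" for y z
    using \<theta> by (auto simp: g_def)
  have [measurable]: "(\<lambda>(y, z). g y z) \<in> borel_measurable (borel \<Otimes>\<^sub>M borel)"
    unfolding g_def by measurable
  have m: "expectation ?g = (\<integral>y. phi \<mu> t (\<theta> * exp (2 * y + 2 * \<mu> * h)) \<partial>density lborel (normal_density 0 (sqrt h)))"
    unfolding phi_def g_def[symmetric]
  proof (rule trans[OF markov_step[OF h t, where C = 1]])
    show "continuous_on UNIV (g y)" for y unfolding g_def by (intro continuous_intros)
    show "0 \<le> z \<Longrightarrow> \<bar>g y z\<bar> \<le> 1" for y z using g01(1)[of y z] g01(2)[of z y] by simp
  qed (simp_all add: g_def)
  have s: "exp (- \<theta> * exp_functional B \<mu> (t + h) \<omega>) = exp (- (\<theta> * exp_functional B \<mu> h \<omega>)) * ?g \<omega>" if "\<omega> \<in> space M" for \<omega>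
    unfolding exp_functional_split[OF that less_imp_le[OF h] less_imp_le[OF t]]
    by (simp add: g_def drifted_def algebra_simps flip: exp_add)
  have ig: "integrable M ?g"
    using g01 sn by (intro integrable_const_bound[where B = 1]) (auto intro!: AE_I2)
  have ish: "integrable M (\<lambda>\<omega>. exp (- \<theta> * exp_functional B \<mu> (t + h) \<omega>))"
    using \<theta> by (intro exp_exp_functional_integrable) simp
  have "\<bar>phi \<mu> (t + h) \<theta> - exp (- \<theta> * h) * expectation ?g\<bar>
    = \<bar>expectation (\<lambda>\<omega>. exp (- \<theta> * exp_functional B \<mu> (t + h) \<omega>) - exp (- \<theta> * h) * ?g \<omega>)\<bar>"
    using ig ish by (simp add: phi_def)
  also have "\<dots> \<le> expectation (\<lambda>\<omega>. \<bar>exp (- \<theta> * exp_functional B \<mu> (t + h) \<omega>) - exp (- \<theta> * h) * ?g \<omega>\<bar>)"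
    by (rule integral_abs_bound)
  also have "\<dots> \<le> expectation (\<lambda>\<omega>. \<theta> * \<bar>exp_functional B \<mu> h \<omega> - h\<bar>)"
  proof (rule integral_mono)
    fix \<omega> assume w: "\<omega> \<in> space M"
    have "exp (- \<theta> * exp_functional B \<mu> (t + h) \<omega>) - exp (- \<theta> * h) * ?g \<omega>
       = (exp (- (\<theta> * exp_functional B \<mu> h \<omega>)) - exp (- (\<theta> * h))) * ?g \<omega>"
      unfolding s[OF w] by (simp add: algebra_simps)
    also have "\<bar>\<dots>\<bar> \<le> \<bar>\<theta> * exp_functional B \<mu> h \<omega> - \<theta> * h\<bar> * 1"
      unfolding abs_mult using g01 sn[OF w] \<theta> h exp_functional_nonneg
      by (intro mult_mono abs_exp_neg_diff_le) auto
    also have "\<dots> = \<theta> * \<bar>exp_functional B \<mu> h \<omega> - h\<bar>"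
      using \<theta> by (simp add: abs_mult flip: right_diff_distrib)
    finally show "\<bar>exp (- \<theta> * exp_functional B \<mu> (t + h) \<omega>) - exp (- \<theta> * h) * ?g \<omega>\<bar> \<le> \<theta> * \<bar>exp_functional B \<mu> h \<omega> - h\<bar>" .
  qed (use i ig ish in auto)
  also have "\<dots> \<le> \<theta> * c" using e \<theta> by simp
  finally show ?thesis unfolding m .
qed

text \<open>The first term comes from T < h, an event of probability at most lam h on which 1 - exp
  (- \<theta> A_T) has mean at most \<theta> E A_h. The second is the error of
  \<open>phi_shift\<close> on T \<ge> h.\<close>

lemma stopped_law_defect_bound:
  assumes lam: "0 < lam" and h: "0 < h" and \<theta>: "0 < \<theta>" and e: "0 < e"
    and i: "integrable M (\<lambda>\<omega>. exp_functional B \<mu> h \<omega>)"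
    and c: "expectation (\<lambda>\<omega>. \<bar>exp_functional B \<mu> h \<omega> - h\<bar>) \<le> e * h"
  shows "\<bar>resolvent_defect lam \<mu> (stopped_law lam \<mu>) \<theta> h\<bar> \<le> \<theta> * (1 + e) * h * (lam * h) + \<theta> * (e * h)"
proof -
  define E where "E = density lborel (exponential_density lam)"
  define G where "G = density lborel (normal_density 0 (sqrt h))"
  have sets_EG [measurable_cong, simp]: "sets E = sets borel" "sets G = sets borel" by (simp_all add: E_def G_def)
  have AE_E: "AE t in E. 0 < t" unfolding E_def by (rule AE_exponential)
  interpret E: prob_space E unfolding E_def by (rule prob_space_exponential_density[OF lam])
  interpret G: prob_space G unfolding G_def using h by (simp add: prob_space_normal_density)
  interpret EG: pair_prob_space E G ..
  define \<psi> where "\<psi> = (\<lambda>t y. phi \<mu> t (\<theta> * exp (2 * y + 2 * \<mu> * h)))"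
  have [measurable]: "(\<lambda>(t, y). \<psi> t y) \<in> borel_measurable (borel \<Otimes>\<^sub>M borel)"
    unfolding \<psi>_def by measurable
  have \<psi>01: "0 \<le> \<psi> t y" "\<psi> t y \<le> 1" for t y
    unfolding \<psi>_def using \<theta> by (auto intro!: phi_bounds)
  have mem: "(\<integral>t. f t \<partial>E) = (\<integral>t. indicator {..<h} t * f t \<partial>E) + exp (- lam * h) * (\<integral>t. f (t + h) \<partial>E)"
    if "f \<in> borel_measurable borel" "\<And>t. \<bar>f t\<bar> \<le> 1" for f :: "real \<Rightarrow> real"
    unfolding E_def using lam h that by (intro exponential_memoryless) auto
  have p01: "0 \<le> phi \<mu> t \<theta>" "phi \<mu> t \<theta> \<le> 1" for t
    using \<theta> by (auto intro!: phi_bounds)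
  have ip: "integrable E (\<lambda>t. phi \<mu> (t + s) \<theta>)" for s
    using p01 by (intro E.integrable_const_bound[where B = 1]) auto
  have ipi: "integrable E (\<lambda>t. indicator {..<h} t * phi \<mu> t \<theta>)"
    using p01 by (intro E.integrable_const_bound[where B = 1]) (auto simp: indicator_def)
  have i1: "integrable E (\<lambda>t. indicator {..<h} t :: real)"
    by (intro E.integrable_const_bound[where B = 1]) (auto simp: indicator_def)
  have one: "(\<integral>t. indicator {..<h} t \<partial>E) = 1 - exp (- lam * h)"
    using mem[of "\<lambda>_. 1"] E.prob_space by simp
  have lap: "laplace (stopped_law lam \<mu>) \<theta> = (\<integral>t. indicator {..<h} t * phi \<mu> t \<theta> \<partial>E) + exp (- lam * h) * (\<integral>t. phi \<mu> (t + h) \<theta> \<partial>E)"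
    using laplace_stopped_law[OF lam less_imp_le[OF \<theta>], of \<mu>] mem[of "\<lambda>t. phi \<mu> t \<theta>"] p01
    by (simp add: E_def[symmetric])
  have i\<psi>: "integrable (E \<Otimes>\<^sub>M G) (\<lambda>(t, y). \<psi> t y)"
    using \<psi>01 by (intro EG.integrable_const_bound[where B = 1]) auto
  have i\<psi>': "integrable E (\<lambda>t. \<integral>y. \<psi> t y \<partial>G)"
    using EG.integrable_fst'[OF i\<psi>] by simp
  have "(\<integral>y. laplace (stopped_law lam \<mu>) (\<theta> * exp (2 * y + 2 * \<mu> * h)) \<partial>G) = (\<integral>y. (\<integral>t. \<psi> t y \<partial>E) \<partial>G)"
    unfolding \<psi>_def E_def using \<theta> lam by (intro Bochner_Integration.integral_cong refl laplace_stopped_law) auto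
  also have "\<dots> = (\<integral>t. (\<integral>y. \<psi> t y \<partial>G) \<partial>E)"
    using EG.integral_snd[OF i\<psi>] EG.integral_fst'[OF i\<psi>] by simp
  finally have gl: "(\<integral>y. laplace (stopped_law lam \<mu>) (\<theta> * exp (2 * y + 2 * \<mu> * h)) \<partial>G) = (\<integral>t. (\<integral>y. \<psi> t y \<partial>G) \<partial>E)" .
  have ee: "exp (- (lam + \<theta>) * h) = exp (- lam * h) * exp (- \<theta> * h)"
    by (simp add: algebra_simps flip: exp_add)
  \<comment> \<open>\<open>X\<close> is the cost of replacing exp (- \<theta> A_T) by 1 before h;
    \<open>Y\<close> is the shift error after h, before the weight exp (- lam h).\<close>
  define X where "X = (\<integral>t. indicator {..<h} t * phi \<mu> t \<theta> \<partial>E) - (\<integral>t. indicator {..<h} t \<partial>E)"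
  define Y where "Y = (\<integral>t. phi \<mu> (t + h) \<theta> \<partial>E) - (\<integral>t. exp (- \<theta> * h) * (\<integral>y. \<psi> t y \<partial>G) \<partial>E)"
  have rd: "resolvent_defect lam \<mu> (stopped_law lam \<mu>) \<theta> h = X + exp (- lam * h) * Y"
    unfolding resolvent_defect_def G_def[symmetric] gl lap ee X_def Y_def one
    by (simp add: algebra_simps)
  have "\<bar>Y\<bar> \<le> \<theta> * (e * h)"
    unfolding Y_def
  proof (rule integral_abs_diff_le[OF E.prob_space_axioms ip])
    show "integrable E (\<lambda>t. exp (- \<theta> * h) * (\<integral>y. \<psi> t y \<partial>G))" using i\<psi>' by simp
    show "AE t in E. \<bar>phi \<mu> (t + h) \<theta> - exp (- \<theta> * h) * (\<integral>y. \<psi> t y \<partial>G)\<bar> \<le> \<theta> * (e * h)"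
      using AE_E unfolding \<psi>_def G_def by eventually_elim (rule phi_shift[OF h _ \<theta> i c])
  qed
  then have Y: "\<bar>exp (- lam * h) * Y\<bar> \<le> \<theta> * (e * h)"
    using lam h by (simp add: abs_mult) (meson abs_ge_zero mult_left_le_one_le order_trans exp_ge_zero exp_le_one_iff mult_nonneg_nonneg neg_le_0_iff_le less_imp_le)
  have Ah: "expectation (\<lambda>\<omega>. exp_functional B \<mu> h \<omega>) \<le> (1 + e) * h"
  proof -
    have "expectation (\<lambda>\<omega>. exp_functional B \<mu> h \<omega>) - h = expectation (\<lambda>\<omega>. exp_functional B \<mu> h \<omega> - h)"
      using i prob_space by simp
    also have "\<dots> \<le> expectation (\<lambda>\<omega>. \<bar>exp_functional B \<mu> h \<omega> - h\<bar>)"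
      using i by (intro integral_mono) auto
    finally show ?thesis using c by (simp add: algebra_simps)
  qed
  \<comment> \<open>Uniform in t < h: exp (- x) \<ge> 1 - x, and A_t \<le> A_h by monotonicity in
    time.\<close>
  have lo: "1 - \<theta> * ((1 + e) * h) \<le> phi \<mu> t \<theta>" if t: "0 < t" "t < h" for t
  proof -
    have "1 - \<theta> * ((1 + e) * h) \<le> 1 - \<theta> * expectation (\<lambda>\<omega>. exp_functional B \<mu> h \<omega>)"
      using Ah \<theta> by (simp add: mult_left_mono)
    also have "\<dots> = expectation (\<lambda>\<omega>. 1 - \<theta> * exp_functional B \<mu> h \<omega>)"
      using i prob_space by simp
    also have "\<dots> \<le> phi \<mu> t \<theta>"
      unfolding phi_def
    proof (rule integral_mono)
      fix \<omega> assume w: "\<omega> \<in> space M"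
      have "1 - \<theta> * exp_functional B \<mu> h \<omega> \<le> 1 - \<theta> * exp_functional B \<mu> t \<omega>"
        using exp_functional_mono[OF w, of t h \<mu>] t \<theta> by (simp add: mult_left_mono)
      also have "\<dots> \<le> exp (- \<theta> * exp_functional B \<mu> t \<omega>)"
        using exp_ge_add_one_self[of "- \<theta> * exp_functional B \<mu> t \<omega>"] by simp
      finally show "1 - \<theta> * exp_functional B \<mu> h \<omega> \<le> exp (- \<theta> * exp_functional B \<mu> t \<omega>)" .
    qed (use i \<theta> in \<open>auto intro!: exp_exp_functional_integrable[simplified]\<close>)
    finally show ?thesis .
  qed
  have "X = (\<integral>t. indicator {..<h} t * phi \<mu> t \<theta> - indicator {..<h} t \<partial>E)"
    unfolding X_def using ipi i1 by simp
  also have "\<bar>\<dots>\<bar> \<le> (\<integral>t. \<bar>indicator {..<h} t * phi \<mu> t \<theta> - indicator {..<h} t\<bar> \<partial>E)"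
    by (rule integral_abs_bound)
  also have "\<dots> \<le> (\<integral>t. \<theta> * ((1 + e) * h) * indicator {..<h} t \<partial>E)"
  proof (rule integral_mono_AE)
    show "AE t in E. \<bar>indicator {..<h} t * phi \<mu> t \<theta> - indicator {..<h} t\<bar> \<le> \<theta> * ((1 + e) * h) * indicator {..<h} t"
      using AE_E
    proof eventually_elim
      case (elim t)
      then show ?case using lo[of t] p01[of t] by (auto simp: indicator_def)
    qed
  qed (use ipi i1 in auto)
  also have "\<dots> = \<theta> * ((1 + e) * h) * (1 - exp (- lam * h))"
    using one by simp
  also have "\<dots> \<le> \<theta> * ((1 + e) * h) * (lam * h)"
    using exp_ge_add_one_self[of "- lam * h"] \<theta> e h by (intro mult_left_mono) auto
  finally have X: "\<bar>X\<bar> \<le> \<theta> * (1 + e) * h * (lam * h)" by (simp add: mult.assoc)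
  show ?thesis unfolding rd using X Y by linarith
qed

lemma stopped_law_defect:
  assumes lam: "0 < lam" and \<theta>: "0 < \<theta>"
  shows "((\<lambda>h. resolvent_defect lam \<mu> (stopped_law lam \<mu>) \<theta> h / h) \<longlongrightarrow> 0) (at_right 0)"
proof (rule tendstoI)
  fix r :: real assume r: "0 < r"
  \<comment> \<open>Makes the shift error \<theta> e h equal to r h / 2; the other term is of order
    h^2.\<close>
  define e where "e = r / (2 * \<theta>)"
  have e: "0 < e" using r \<theta> by (simp add: e_def)
  have "((\<lambda>h. \<theta> * (1 + e) * (lam * h)) \<longlongrightarrow> \<theta> * (1 + e) * (lam * 0)) (at_right 0)"
    by (intro tendsto_intros)
  then have "\<forall>\<^sub>F h in at_right 0. \<theta> * (1 + e) * (lam * h) < r / 2"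
    by (rule order_tendstoD(2)) (use r in simp)
  moreover have "\<forall>\<^sub>F h in at_right (0::real). 0 < h" by (simp add: eventually_at_right_less)
  ultimately show "\<forall>\<^sub>F h in at_right 0. dist (resolvent_defect lam \<mu> (stopped_law lam \<mu>) \<theta> h / h) 0 < r"
    using exp_functional_close[OF e, of \<mu>]
  proof eventually_elim
    case (elim h)
    then have "\<bar>resolvent_defect lam \<mu> (stopped_law lam \<mu>) \<theta> h\<bar> \<le> \<theta> * (1 + e) * h * (lam * h) + \<theta> * (e * h)"
      by (intro stopped_law_defect_bound lam \<theta> e) auto
    also have "\<dots> = (\<theta> * (1 + e) * (lam * h) + r / 2) * h"
      using \<theta> by (simp add: e_def field_simps)
    also have "\<dots> < r * h" using elim by (intro mult_strict_right_mono) auto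
    finally show ?case using elim by (simp add: abs_divide pos_divide_less_eq)
  qed
qed

lemma stopped_law_eq_ratio_law:
  assumes a: "0 < a" and b: "0 < b"
  shows "stopped_law (2 * a * b) (a - b) = ratio_law a b"
proof (rule eq_of_resolvent_defect)
  show lam: "0 < 2 * a * b" using a b by simp
  show "real_distribution (stopped_law (2 * a * b) (a - b))" "AE x in stopped_law (2 * a * b) (a - b). 0 < x"
    using lam by (rule real_distribution_stopped_law)+
  show "real_distribution (ratio_law a b)" "AE x in ratio_law a b. 0 < x"
    using a b by (rule real_distribution_ratio_law)+
  show "((\<lambda>h. resolvent_defect (2 * a * b) (a - b) (stopped_law (2 * a * b) (a - b)) \<theta> h / h) \<longlongrightarrow> 0) (at_right 0)"
    if "0 < \<theta>" for \<theta> using lam that by (rule stopped_law_defect)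
  show "((\<lambda>h. resolvent_defect (2 * a * b) (a - b) (ratio_law a b) \<theta> h / h) \<longlongrightarrow> 0) (at_right 0)"
    if "0 < \<theta>" for \<theta>
    using real_distribution_ratio_law[OF a b] that ratio_law_generator[OF a b that]
    by (rule resolvent_defect_tendsto_0)
qed

text \<open>Finiteness at the random time gives finiteness at almost every fixed time by iterated
  integration, and monotonicity of A_t upgrades this to every t \<ge> 0. The quotient C / lam undoes
  the normalisation of the exponential density.\<close>

lemma call_expectation:
  assumes lam: "0 < lam" and C: "0 \<le> C"
    and nn: "(\<integral>\<^sup>+x. ennreal (max (x - k) 0) \<partial>stopped_law lam \<mu>) = ennreal C"
  shows "\<And>t. 0 \<le> t \<Longrightarrow> integrable M (\<lambda>\<omega>. max (exp_functional B \<mu> t \<omega> - k) 0)"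
    and "has_bochner_integral lborel (\<lambda>t. indicator {0..} t * (exp (- lam * t) *
      expectation (\<lambda>\<omega>. max (exp_functional B \<mu> t \<omega> - k) 0))) (C / lam)"
proof -
  define E where "E = density lborel (exponential_density lam)"
  have [measurable_cong, simp]: "sets E = sets borel" by (simp add: E_def)
  interpret E: prob_space E unfolding E_def by (rule prob_space_exponential_density[OF lam])
  define c where "c = (\<lambda>t. \<integral>\<^sup>+\<omega>. ennreal (max (exp_functional B \<mu> t \<omega> - k) 0) \<partial>M)"
  have [measurable]: "c \<in> borel_measurable borel" unfolding c_def by measurable
  have cE: "(\<integral>\<^sup>+t. c t \<partial>E) = ennreal C"
  proof -
    have "ennreal C = (\<integral>\<^sup>+p. ennreal (max (exp_functional B \<mu> (fst p) (snd p) - k) 0) \<partial>(E \<Otimes>\<^sub>M M))"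
      unfolding nn[symmetric] stopped_law_def E_def[symmetric]
      by (subst nn_integral_distr) (auto simp: case_prod_unfold)
    also have "\<dots> = (\<integral>\<^sup>+t. c t \<partial>E)"
      unfolding c_def by (subst nn_integral_fst[symmetric]) auto
    finally show ?thesis by simp
  qed
  have "AE t in E. c t \<noteq> \<infinity>"
    by (rule nn_integral_PInf_AE) (auto simp: cE)
  then have AEc: "AE t in lborel. 0 < ennreal (exponential_density lam t) \<longrightarrow> c t \<noteq> \<infinity>"
    unfolding E_def by (subst (asm) AE_density) auto
  have cfin: "c t < \<infinity>" if t: "0 \<le> t" for t
  proof (rule ccontr)
    assume "\<not> c t < \<infinity>"
    then have inf: "c t = \<infinity>" by (simp add: less_top[symmetric])
    \<comment> \<open>An infinite value would persist at all later times, hence on an interval of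
      positive measure.\<close>
    have cs: "c s = \<infinity>" if "s > t" for s
    proof -
      have "c t \<le> c s"
        unfolding c_def using that t exp_functional_mono[of _ t s \<mu>]
        by (intro nn_integral_mono ennreal_leI max.mono) auto
      then show ?thesis using inf by (simp add: top_unique)
    qed
    have "AE s in lborel. s \<notin> {t<..<t + 1}"
      using AEc by eventually_elim (use t lam cs in \<open>auto simp: exponential_density_def\<close>)
    then have "emeasure lborel {t<..<t + 1} = 0"
      by (subst (asm) AE_iff_null_sets[symmetric]) auto
    then show False by simp
  qed
  show int: "integrable M (\<lambda>\<omega>. max (exp_functional B \<mu> t \<omega> - k) 0)" if "0 \<le> t" for t
    using cfin[OF that] by (intro integrableI_bounded) (auto simp: c_def)
  let ?f = "\<lambda>t. indicator {0..} t * (exp (- lam * t) * expectation (\<lambda>\<omega>. max (exp_functional B \<mu> t \<omega> - k) 0))"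
  have "has_bochner_integral lborel (\<lambda>t. lam * ?f t) C"
  proof (rule has_bochner_integral_nn_integral)
    show "(\<lambda>t. lam * ?f t) \<in> borel_measurable lborel" by measurable
    show "AE t in lborel. 0 \<le> lam * ?f t" using lam by (auto intro!: AE_I2)
    have "(\<integral>\<^sup>+t. c t \<partial>E) = (\<integral>\<^sup>+t. ennreal (exponential_density lam t) * c t \<partial>lborel)"
      unfolding E_def by (rule nn_integral_density) auto
    also have "\<dots> = (\<integral>\<^sup>+t. ennreal (lam * ?f t) \<partial>lborel)"
    proof (rule nn_integral_cong)
      fix t :: real
      show "ennreal (exponential_density lam t) * c t = ennreal (lam * ?f t)"
      proof (cases "0 \<le> t")
        case True
        have "c t = ennreal (expectation (\<lambda>\<omega>. max (exp_functional B \<mu> t \<omega> - k) 0))"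
          unfolding c_def by (rule nn_integral_eq_integral[OF int[OF True]]) auto
        then show ?thesis
          using True lam by (simp add: exponential_density_def ennreal_mult[symmetric] mult_ac)
      qed (simp add: exponential_density_def)
    qed
    finally show "(\<integral>\<^sup>+t. ennreal (lam * ?f t) \<partial>lborel) = ennreal C" using cE by simp
  qed (rule C)
  from has_bochner_integral_mult_right[OF this, of "1 / lam"]
  show "has_bochner_integral lborel ?f (C / lam)" using lam by simp
qed

end

section \<open>Translation of the parameters and conclusion\<close>

theorem theorem2p2:
  fixes M :: "'a measure" and B :: "real \<Rightarrow> 'a \<Rightarrow> real" and \<mu> lam k \<nu> a b :: real
  assumes "brownian_motion M B"
    and "lam > max (2 * (1 + \<mu>)) 0"
    and "k > 0"
    and "\<nu> = sqrt (2 * lam + \<mu>\<^sup>2)"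
    and "a = (\<nu> + \<mu>) / 2"
    and "b = (\<nu> - \<mu>) / 2"
  shows "(\<forall>t\<ge>0. integrable M (\<lambda>\<omega>. pos_part (exp_functional B \<mu> t \<omega> - k))) \<and>
    set_integrable lborel {0..}
      (\<lambda>t. exp (- lam * t) * (\<integral>\<omega>. pos_part (exp_functional B \<mu> t \<omega> - k) \<partial>M)) \<and>
    set_integrable lborel {0<..<1 / (2 * k)}
      (\<lambda>t. exp (- t) * t powr (b - 2) * (1 - 2 * k * t) powr (a + 1)) \<and>
    lam * (LINT t:{0..}|lborel.
        exp (- lam * t) * (\<integral>\<omega>. pos_part (exp_functional B \<mu> t \<omega> - k) \<partial>M)) =
      1 / ((lam - 2 * (1 + \<mu>)) * Gamma (b - 1)) *
        (LINT t:{0<..<1 / (2 * k)}|lborel.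
          exp (- t) * t powr (b - 2) * (1 - 2 * k * t) powr (a + 1))"
proof -
  interpret brownian_motion M B by fact
  have lam: "0 < lam" "2 * (1 + \<mu>) < lam" using assms(2) by auto
  have "sqrt (\<mu>\<^sup>2) < \<nu>" unfolding assms(4) using lam by (intro real_sqrt_less_mono) simp
  then have \<nu>: "\<bar>\<mu>\<bar> < \<nu>" by simp
  have a: "0 < a" and b0: "0 < b" using \<nu> unfolding assms(5,6) by auto
  have \<mu>: "\<mu> = a - b" unfolding assms(5,6) by (simp add: field_simps)
  have "\<nu>\<^sup>2 = 2 * lam + \<mu>\<^sup>2" unfolding assms(4) using lam by simp
  moreover have "\<nu>\<^sup>2 - \<mu>\<^sup>2 = 4 * (a * b)" unfolding assms(5,6) by (simp add: power2_eq_square algebra_simps)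
  ultimately have lam_eq: "lam = 2 * a * b" by simp
  \<comment> \<open>This factorisation produces the prefactor of the formula and, since a + 1 > 0,
    turns the hypothesis on lam into b > 1.\<close>
  have factor: "lam - 2 * (1 + \<mu>) = 2 * (b - 1) * (a + 1)"
    unfolding lam_eq \<mu> by (simp add: algebra_simps)
  then have "0 < (2 * (b - 1)) * (a + 1)" using lam by linarith
  then have "0 < 2 * (b - 1)" by (rule zero_less_mult_pos2) (use a in simp)
  then have b: "1 < b" by simp
  let ?w = "\<lambda>t. exp (- t) * t powr (b - 2) * (1 - 2 * k * t) powr (a + 1)"
  define C where "C = 1 / (2 * (b - 1) * (a + 1) * Gamma (b - 1)) * (LINT t:{0<..<1 / (2 * k)}|lborel. ?w t)"
  have "0 < Gamma (b - 1)" using b by (intro Gamma_real_pos) simp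
  then have C: "0 \<le> C"
    unfolding C_def set_lebesgue_integral_def using a b
    by (intro mult_nonneg_nonneg Bochner_Integration.integral_nonneg) (auto simp: less_imp_le)
  have "(\<integral>\<^sup>+x. ennreal (max (x - k) 0) \<partial>stopped_law lam \<mu>) = ennreal C"
    using ratio_law_call[OF a b assms(3)] stopped_law_eq_ratio_law[OF a b0]
    by (simp add: C_def lam_eq \<mu>)
  note call = call_expectation[OF lam(1) C this]
  have "lam * (C / lam) = 1 / ((lam - 2 * (1 + \<mu>)) * Gamma (b - 1)) * (LINT t:{0<..<1 / (2 * k)}|lborel. ?w t)"
    unfolding factor using lam by (simp add: C_def)
  then show ?thesis
    using call call_weight_integrable[OF b assms(3) a]
    by (simp add: pos_part_def set_integrable_def set_lebesgue_integral_def has_bochner_integral_iff)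
qed

end
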